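(* Let $n>0$ be a natural number. Then the following two meromorphic functions in the four variables $t_1,t_2,\mu_1,\mu_2\in\mathbb{C}^*$ (and in $\tau$, $\operatorname{im}(\tau)>0$) are equal: $$A_n(t_1,t_2,\mu_1,\mu_2)=\sum_{k=1}^{n}\delta\left(\frac{t_1^{n-k+1}}{t_2^{k-1}},\,\mu_1^{k}\mu_2^{n-k}\right)\,\delta\left(\frac{t_2^{k}}{t_1^{n-k}},\,\mu_1^{k-1}\mu_2^{n-k+1}\right)$$ and $$B_n(t_1,t_2,\mu_1,\mu_2)=\frac1n\sum_{k=0}^{n-1}\sum_{\ell=0}^{n-1}\left(\frac{\mu_2}{\mu_1}\right)^{\ell}\,\delta\left(\mathrm{e}\left(\tfrac{k-\ell\tau}{n}\right)t_1,\,\mu_1^n\right)\,\delta\left(\mathrm{e}\left(\tfrac{\ell\tau-k}{n}\right)t_2,\,\mu_2^n\right).$$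
   Context: Notation: $\mathrm{e}(x)=e^{2\pi i x}$. Let $\tau\in\mathbb{C}$ with $\operatorname{im}(\tau)>0$ and $q=\mathrm{e}(\tau)=e^{2\pi i\tau}$. The Jacobi theta function is $$\theta_\tau(\upsilon)=2q^{1/8}\sin(\pi\upsilon)\prod_{l=1}^\infty(1-q^l)\big(1-q^l\mathrm{e}(\upsilon)\big)\big(1-q^l/\mathrm{e}(\upsilon)\big),\qquad q^{1/8}:=e^{\pi i\tau/4}.$$ Put $$\Delta_\tau(a,b)=\frac{\theta_\tau'(0)\,\theta_\tau(a+b)}{\theta_\tau(a)\,\theta_\tau(b)},$$ where $\theta_\tau'$ is the derivative in $\upsilon$. Since $\Delta_\tau(a+1,b)=\Delta_\tau(a,b)=\Delta_\tau(a,b+1)$, there is a well-defined meromorphic function $\delta$ on $\mathbb{C}^*\times\mathbb{C}^*$ (depending on $\tau$) given by $$\delta(\mathrm{e}(a),\mathrm{e}(b))=\frac1{2\pi i}\Delta_\tau(a,b).$$ Equivalently, $\delta(A,B)=\dfrac{\vartheta'(1)\,\vartheta(AB)}{\vartheta(A)\,\vartheta(B)}$ with $\vartheta(x)=x^{1/2}(1-x^{-1})\prod_{\ell=1}^\infty(1-q^\ell x)(1-q^\ell/x)$, where the half-integer powers cancel in the quotient. *)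

theory Defs
  imports "HOL-Complex_Analysis.Complex_Analysis"
begin

definition ee :: "complex \<Rightarrow> complex" where
  "ee x = exp (2 * of_real pi * \<i> * x)"

(* The product is over l \<ge> 1, hence the exponent Suc l. *)
definition theta :: "complex \<Rightarrow> complex \<Rightarrow> complex" where
  "theta \<tau> v =
     2 * exp (of_real pi * \<i> * \<tau> / 4) * sin (of_real pi * v) *
     (\<Prod>l. (1 - ee \<tau> ^ Suc l) * (1 - ee \<tau> ^ Suc l * ee v) * (1 - ee \<tau> ^ Suc l / ee v))"

definition Delta :: "complex \<Rightarrow> complex \<Rightarrow> complex \<Rightarrow> complex" where
  "Delta \<tau> a b = deriv (theta \<tau>) 0 * theta \<tau> (a + b) / (theta \<tau> a * theta \<tau> b)"

(* A logarithm for ee: on nonzero arguments it is a right inverse. *)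
definition lg :: "complex \<Rightarrow> complex" where
  "lg A = Ln A / (2 * of_real pi * \<i>)"

(* The value does not depend on the branch of the logarithm, see delta_ee. *)
definition delta :: "complex \<Rightarrow> complex \<Rightarrow> complex \<Rightarrow> complex" where
  "delta \<tau> A B = 1 / (2 * of_real pi * \<i>) * Delta \<tau> (lg A) (lg B)"

(* delta \<tau> is locally a quotient of holomorphic functions of (A, B); this is the set of points of
   C^* x C^* at which the denominator of that quotient does not vanish, i.e. where neither A
   nor B is an integral power of ee \<tau>, see delta_regular_iff. Outside of this set the value
   of delta is the junk value 0 of division by zero. *)
definition delta_regular :: "complex \<Rightarrow> complex \<Rightarrow> complex \<Rightarrow> bool" where
  "delta_regular \<tau> A B \<longleftrightarrow>
     A \<noteq> 0 \<and> B \<noteq> 0 \<and> theta \<tau> (lg A) \<noteq> 0 \<and> theta \<tau> (lg B) \<noteq> 0"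

definition A_fun :: "nat \<Rightarrow> complex \<Rightarrow> complex \<Rightarrow> complex \<Rightarrow> complex \<Rightarrow> complex \<Rightarrow> complex" where
  "A_fun n \<tau> t1 t2 \<mu>1 \<mu>2 =
     (\<Sum>k=1..n. delta \<tau> (t1 ^ (n - k + 1) / t2 ^ (k - 1)) (\<mu>1 ^ k * \<mu>2 ^ (n - k)) *
                delta \<tau> (t2 ^ k / t1 ^ (n - k)) (\<mu>1 ^ (k - 1) * \<mu>2 ^ (n - k + 1)))"

definition A_regular :: "nat \<Rightarrow> complex \<Rightarrow> complex \<Rightarrow> complex \<Rightarrow> complex \<Rightarrow> complex \<Rightarrow> bool" where
  "A_regular n \<tau> t1 t2 \<mu>1 \<mu>2 \<longleftrightarrow>
     (\<forall>k\<in>{1..n}. delta_regular \<tau> (t1 ^ (n - k + 1) / t2 ^ (k - 1)) (\<mu>1 ^ k * \<mu>2 ^ (n - k)) \<and>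
                 delta_regular \<tau> (t2 ^ k / t1 ^ (n - k)) (\<mu>1 ^ (k - 1) * \<mu>2 ^ (n - k + 1)))"

definition B_fun :: "nat \<Rightarrow> complex \<Rightarrow> complex \<Rightarrow> complex \<Rightarrow> complex \<Rightarrow> complex \<Rightarrow> complex" where
  "B_fun n \<tau> t1 t2 \<mu>1 \<mu>2 =
     1 / of_nat n *
     (\<Sum>k=0..<n. \<Sum>l=0..<n. (\<mu>2 / \<mu>1) ^ l *
        delta \<tau> (ee ((of_nat k - of_nat l * \<tau>) / of_nat n) * t1) (\<mu>1 ^ n) *
        delta \<tau> (ee ((of_nat l * \<tau> - of_nat k) / of_nat n) * t2) (\<mu>2 ^ n))"

definition B_regular :: "nat \<Rightarrow> complex \<Rightarrow> complex \<Rightarrow> complex \<Rightarrow> complex \<Rightarrow> complex \<Rightarrow> bool" where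
  "B_regular n \<tau> t1 t2 \<mu>1 \<mu>2 \<longleftrightarrow>
     (\<forall>k\<in>{0..<n}. \<forall>l\<in>{0..<n}.
        delta_regular \<tau> (ee ((of_nat k - of_nat l * \<tau>) / of_nat n) * t1) (\<mu>1 ^ n) \<and>
        delta_regular \<tau> (ee ((of_nat l * \<tau> - of_nat k) / of_nat n) * t2) (\<mu>2 ^ n))"

lemma ee_nonzero [simp]: "ee x \<noteq> 0"
  by (simp add: ee_def)

lemma ee_lg: "A \<noteq> 0 \<Longrightarrow> ee (lg A) = A"
  by (simp add: ee_def lg_def)

lemma ee_eq_iff: "ee x = ee y \<longleftrightarrow> (\<exists>m::int. x = y + of_int m)"
proof -
  have "ee x = ee y \<longleftrightarrow> (\<exists>m::int. 2 * of_real pi * \<i> * x = 2 * of_real pi * \<i> * y + (of_int (2 * m) * pi) * \<i>)"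
    unfolding ee_def by (rule exp_eq)
  also have "\<dots> \<longleftrightarrow> (\<exists>m::int. x = y + of_int m)"
  proof (rule ex_cong1)
    fix m :: int
    have "2 * of_real pi * \<i> * x = 2 * of_real pi * \<i> * y + (of_int (2 * m) * of_real pi) * \<i>
       \<longleftrightarrow> (2 * of_real pi * \<i>) * x = (2 * of_real pi * \<i>) * (y + of_int m)"
      by (simp add: algebra_simps)
    also have "\<dots> \<longleftrightarrow> x = y + of_int m"
      by (subst mult_cancel_left) simp
    finally show "2 * of_real pi * \<i> * x = 2 * of_real pi * \<i> * y + (of_int (2 * m) * pi) * \<i>
       \<longleftrightarrow> x = y + of_int m" by simp
  qed
  finally show ?thesis .
qed

lemma ee_add_1 [simp]: "ee (x + 1) = ee x"
  by (subst ee_eq_iff) (rule exI [of _ 1], simp)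

lemma theta_add_1: "theta \<tau> (v + 1) = - theta \<tau> v"
proof -
  have "sin (of_real pi * (v + 1)) = - sin (of_real pi * v)"
    by (simp add: distrib_left sin_add flip: sin_of_real cos_of_real)
  then show ?thesis by (simp add: theta_def)
qed

lemma Delta_add_1: "Delta \<tau> (a + 1) b = Delta \<tau> a b" "Delta \<tau> a (b + 1) = Delta \<tau> a b"
proof -
  have "theta \<tau> (a + 1 + b) = - theta \<tau> (a + b)" "theta \<tau> (a + (b + 1)) = - theta \<tau> (a + b)"
    using theta_add_1 [of \<tau> "a + b"] by (simp_all add: add_ac)
  then show "Delta \<tau> (a + 1) b = Delta \<tau> a b" "Delta \<tau> a (b + 1) = Delta \<tau> a b"
    by (simp_all add: Delta_def theta_add_1)
qed

lemma periodic_of_int: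
  fixes f :: "complex \<Rightarrow> 'a"
  assumes "\<And>x. f (x + 1) = f x"
  shows "f (x + of_int m) = f x"
proof (induction m rule: int_induct [where k = 0])
  case (step1 i)
  then show ?case using assms [of "x + of_int i"] by (simp add: add_ac)
next
  case (step2 i)
  then show ?case using assms [of "x + of_int (i - 1)"] by simp
qed simp

lemma delta_ee: "delta \<tau> (ee a) (ee b) = 1 / (2 * of_real pi * \<i>) * Delta \<tau> a b"
proof -
  obtain m where m: "lg (ee a) = a + of_int m"
    using ee_lg [of "ee a"] ee_eq_iff by auto
  obtain m' where m': "lg (ee b) = b + of_int m'"
    using ee_lg [of "ee b"] ee_eq_iff by auto
  have "Delta \<tau> (a + of_int m) (b + of_int m') = Delta \<tau> a b"
    using periodic_of_int [of "\<lambda>a. Delta \<tau> a (b + of_int m')" a m]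
          periodic_of_int [of "\<lambda>b. Delta \<tau> a b" b m'] Delta_add_1 by simp
  then show ?thesis by (simp add: delta_def m m')
qed

lemma norm_ee_less_1: "Im \<tau> > 0 \<Longrightarrow> norm (ee \<tau>) < 1"
  by (simp add: ee_def norm_exp_eq_Re)

lemma convergent_prod_1_minus_geometric:
  fixes q c :: complex
  assumes "norm q < 1"
  shows "convergent_prod (\<lambda>l. 1 - q ^ Suc l * c)"
proof -
  have "summable (\<lambda>l. norm q ^ l * (norm q * norm c))"
    using assms by (intro summable_mult2 summable_geometric) simp
  then have "summable (\<lambda>l. norm ((1 - q ^ Suc l * c) - 1))"
    by (simp add: norm_mult norm_power mult_ac)
  then show ?thesis
    by (intro abs_convergent_prod_imp_convergent_prod) (simp add: abs_convergent_prod_conv_summable)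
qed

lemma convergent_prod_theta:
  assumes "Im \<tau> > 0"
  shows "convergent_prod (\<lambda>l. (1 - ee \<tau> ^ Suc l) * (1 - ee \<tau> ^ Suc l * x) * (1 - ee \<tau> ^ Suc l / x))"
proof -
  note conv = convergent_prod_1_minus_geometric [OF norm_ee_less_1 [OF assms]]
  show ?thesis
    using convergent_prod_mult [OF convergent_prod_mult [OF conv [of 1] conv [of x]] conv [of "inverse x"]]
    by (simp add: field_class.field_divide_inverse)
qed

lemma theta_eq_0_iff:
  assumes "Im \<tau> > 0"
  shows "theta \<tau> v = 0 \<longleftrightarrow> (\<exists>m::int. ee v = ee \<tau> powi m)"
proof -
  let ?q = "ee \<tau>" and ?x = "ee v"
  let ?f = "\<lambda>l. (1 - ?q ^ Suc l) * (1 - ?q ^ Suc l * ?x) * (1 - ?q ^ Suc l / ?x)"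
  have "?f has_prod prodinf ?f"
    using convergent_prod_theta [OF assms] by (rule convergent_prod_has_prod)
  then have 1: "prodinf ?f = 0 \<longleftrightarrow> (\<exists>l. ?f l = 0)"
    using has_prod_eq_0_iff by (metis (no_types, lifting) imageE rangeI)
  have "?q ^ Suc l \<noteq> 1" for l
  proof
    assume "?q ^ Suc l = 1"
    then have "norm ?q ^ Suc l = 1"
      by (metis norm_one norm_power)
    moreover have "norm ?q ^ Suc l < 1"
      using norm_ee_less_1 [OF assms] by (intro power_less_one_iff [THEN iffD2]) auto
    ultimately show False by simp
  qed
  then have 2: "?f l = 0 \<longleftrightarrow> ?x = inverse (?q ^ Suc l) \<or> ?x = ?q ^ Suc l" for l
  proof -
    have "?q ^ Suc l \<noteq> 0" by simp
    then have "1 - ?q ^ Suc l * ?x = 0 \<longleftrightarrow> ?x = inverse (?q ^ Suc l)"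
      by (metis inverse_unique right_inverse right_minus_eq)
    moreover have "1 - ?q ^ Suc l / ?x = 0 \<longleftrightarrow> ?x = ?q ^ Suc l"
      by (metis divide_eq_1_iff ee_nonzero right_minus_eq)
    moreover have "1 - ?q ^ Suc l \<noteq> 0"
      using \<open>\<And>l. ?q ^ Suc l \<noteq> 1\<close> [of l] by simp
    ultimately show ?thesis
      by (simp only: mult_eq_0_iff) blast
  qed
  have 3: "sin (of_real pi * v) = 0 \<longleftrightarrow> ?x = 1"
  proof -
    have "sin (of_real pi * v) = 0 \<longleftrightarrow> (\<exists>m::int. v = of_int m)"
      by (simp add: sin_eq_0 mult.commute)
    also have "\<dots> \<longleftrightarrow> ?x = ee 0"
      unfolding ee_eq_iff by simp
    finally show ?thesis by (simp add: ee_def)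
  qed
  have "theta \<tau> v = 0 \<longleftrightarrow> ?x = 1 \<or> (\<exists>l. ?x = inverse (?q ^ Suc l) \<or> ?x = ?q ^ Suc l)"
    unfolding theta_def mult_eq_0_iff [of _ "prodinf ?f"] 1 using 2 3 by simp
  also have "\<dots> \<longleftrightarrow> (\<exists>m::int. ?x = ?q powi m)"
  proof
    assume "?x = 1 \<or> (\<exists>l. ?x = inverse (?q ^ Suc l) \<or> ?x = ?q ^ Suc l)"
    then consider "?x = 1" | l where "?x = inverse (?q ^ Suc l)" | l where "?x = ?q ^ Suc l"
      by blast
    then show "\<exists>m::int. ?x = ?q powi m"
    proof cases
      case 1
      then show ?thesis by (intro exI [of _ 0]) simp
    next
      case (2 l)
      then show ?thesis by (intro exI [of _ "- int (Suc l)"]) (simp add: power_int_minus del: of_nat_Suc)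
    next
      case (3 l)
      then show ?thesis by (intro exI [of _ "int (Suc l)"]) (simp del: of_nat_Suc)
    qed
  next
    assume "\<exists>m::int. ?x = ?q powi m"
    then obtain m :: int where m: "?x = ?q powi m" by blast
    consider "m = 0" | l where "m = int (Suc l)" | l where "m = - int (Suc l)"
      by (metis int_cases3 Suc_pred)
    then show "?x = 1 \<or> (\<exists>l. ?x = inverse (?q ^ Suc l) \<or> ?x = ?q ^ Suc l)"
      using m by cases (auto simp: power_int_minus simp del: of_nat_Suc power_Suc)
  qed
  finally show ?thesis .
qed

lemma delta_regular_iff:
  assumes "Im \<tau> > 0"
  shows "delta_regular \<tau> A B \<longleftrightarrow>
    A \<noteq> 0 \<and> B \<noteq> 0 \<and> (\<forall>m::int. A \<noteq> ee \<tau> powi m) \<and> (\<forall>m::int. B \<noteq> ee \<tau> powi m)"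
  by (auto simp: delta_regular_def theta_eq_0_iff [OF assms] ee_lg)

end

theory Submission
  imports Defs
begin

text \<open>
  Up to sign, \<open>delta\<close> is Kronecker's function: for \<open>|q| < |A| < 1\<close> and \<open>B\<close> outside of
  \<open>q\<^sup>\<int>\<close>, \<open>delta \<tau> A B = - (\<Sum>m\<in>\<int>. A\<^sup>m / (1 - B q\<^sup>m))\<close>
  (lemma \<open>kronecker\<close>). The theorem is the comparison of two double series obtained from this
  expansion.

  Put \<open>p = e(\<tau>/n)\<close>, so \<open>q = p\<^sup>n\<close>, and let \<open>|q| < |t1| < |p|\<^sup>n\<^sup>-\<^sup>1\<close>, \<open>|p| < |t2| < 1\<close>.
  There every first argument of \<open>delta\<close> on the B side lies in the annulus, and
  every one on the A side does so after multiplication by a power of \<open>q\<close>, which by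
  \<open>delta(q A, B) = delta(A, B) / B\<close> costs only a monomial. All the double
  series converge absolutely, so they may be rearranged.

  \<^item> On the B side, averaging over \<open>k\<close> is averaging over \<open>n\<close>-th roots of unity. It keeps
    exactly the terms \<open>t1\<^sup>a t2\<^sup>b\<close> with \<open>b = a + n c\<close>. The sum over \<open>\<ell>\<close> then is the geometric sum
    \<open>1 + z + \<dots> + z\<^sup>n\<^sup>-\<^sup>1\<close> with \<open>z = (\<mu>2/\<mu>1) q\<^sup>c\<close>, so the coefficient of \<open>t1\<^sup>a t2\<^sup>a\<^sup>+\<^sup>n\<^sup>c\<close> is
    \<open>(1 + z + \<dots> + z\<^sup>n\<^sup>-\<^sup>1) / ((1 - X) (1 - X z\<^sup>n))\<close> with \<open>X = \<mu>1\<^sup>n q\<^sup>a\<close>.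

  \<^item> On the A side, a unimodular change of the two summation indices in the summand \<open>k = n - j\<close>
    produces the same monomials, with coefficient
    \<open>z\<^sup>j / ((1 - X z\<^sup>j) (1 - X z\<^sup>j\<^sup>+\<^sup>1))\<close>. These fractions telescope over \<open>j = 0, \<dots>, n - 1\<close>
    to the coefficient found on the B side (lemma \<open>sum_geometric_telescope\<close>).

  The identity extends from this region to all regular points by analytic continuation
  along a complex line in the logarithms of \<open>t1\<close> and \<open>t2\<close>: the excluded parameters on the line
  are the zeros of an entire function, hence a countable set, and the rest of the line is connected.

  Kronecker's expansion is proved by a Liouville argument. For fixed \<open>A\<close>, the poles at
  \<open>B = 1\<close> of the two sides have the same residue, so the difference of the sides is holomorphic
  for \<open>|q| < |B| < 1/|q|\<close>. Both sides are divided by \<open>A\<close> under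
  \<open>B \<mapsto> q B\<close>. After multiplication by a suitable power of \<open>B\<close>, the modulus of the difference is
  doubly periodic in \<open>log B\<close>, so it attains a maximum; hence that product is constant,
  and its monodromy around \<open>0\<close> forces the constant to vanish.
\<close>

section \<open>The theta function as a function of the multiplicative variable\<close>

definition qpoch :: "complex \<Rightarrow> complex \<Rightarrow> complex" where
  "qpoch q x = (\<Prod>l. 1 - q ^ l * x)"

text \<open>
  The function \<open>\<vartheta>\<close> freed of its half-integer power: it is single-valued on the punctured plane and
  equals \<open>(1 - x) (\<Prod>l\<ge>1. (1 - q\<^sup>l) (1 - q\<^sup>l x) (1 - q\<^sup>l / x))\<close>. Writing it in terms of
  \<open>qpoch\<close> reduces its functional equation to the recursion \<open>qpoch_rec\<close>.
\<close>

definition jtheta :: "complex \<Rightarrow> complex \<Rightarrow> complex" where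
  "jtheta q x = qpoch q q * qpoch q x * qpoch q (q / x)"

text \<open>
  Kronecker's function, with the sign of the series and not of \<open>delta\<close>; the cube of
  \<open>qpoch q q\<close> is minus the derivative of \<open>jtheta q\<close> at 1.
\<close>

definition kron :: "complex \<Rightarrow> complex \<Rightarrow> complex \<Rightarrow> complex" where
  "kron q A B = qpoch q q ^ 3 * jtheta q (A * B) / (jtheta q A * jtheta q B)"

lemma summable_qpoch:
  fixes q x :: complex
  assumes "norm q < 1"
  shows "summable (\<lambda>l. norm (q ^ l * x))"
  using assms by (simp add: norm_mult norm_power summable_mult2 summable_geometric)

lemma convergent_prod_qpoch:
  fixes q x :: complex
  assumes "norm q < 1"
  shows "convergent_prod (\<lambda>l. 1 - q ^ l * x)"
  using summable_qpoch[OF assms, of x]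
  by (intro abs_convergent_prod_imp_convergent_prod) (simp add: abs_convergent_prod_conv_summable)

lemma qpoch_has_prod:
  assumes "norm q < 1"
  shows "(\<lambda>l. 1 - q ^ l * x) has_prod qpoch q x"
  unfolding qpoch_def using convergent_prod_qpoch[OF assms] by (rule convergent_prod_has_prod)

lemma qpoch_eq_0_iff:
  assumes "norm q < 1"
  shows "qpoch q x = 0 \<longleftrightarrow> (\<exists>l. q ^ l * x = 1)"
  using has_prod_eq_0_iff[OF qpoch_has_prod[OF assms, of x]] by (auto simp: image_iff)

lemma qpoch_rec:
  assumes "norm q < 1"
  shows "qpoch q x = (1 - x) * qpoch q (q * x)"
proof -
  have "(\<lambda>l. 1 - q ^ l * x) has_prod ((\<Prod>k<1. 1 - q ^ k * x) * (\<Prod>k. 1 - q ^ (k + 1) * x))"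
    by (rule has_prod_ignore_initial_segment'[OF convergent_prod_qpoch[OF assms]])
  then have "qpoch q x = (\<Prod>k<1. 1 - q ^ k * x) * (\<Prod>k. 1 - q ^ (k + 1) * x)"
    using qpoch_has_prod[OF assms] has_prod_unique2 by blast
  then show ?thesis
    by (simp add: qpoch_def mult_ac)
qed

lemma holomorphic_qpoch:
  assumes "norm q < 1"
  shows "qpoch q holomorphic_on UNIV"
proof (rule holomorphic_uniform_sequence)
  show "(\<lambda>x. \<Prod>l<n. 1 - q ^ l * x) holomorphic_on UNIV" for n
    by (intro holomorphic_intros)
  fix x :: complex
  have "uniformly_convergent_on (cball x 1) (\<lambda>N x. \<Prod>l<N. 1 - q ^ l * x)"
  proof (rule uniformly_convergent_on_prod')
    show "uniformly_convergent_on (cball x 1) (\<lambda>N x. \<Sum>l<N. norm ((1 - q ^ l * x) - 1))"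
    proof (rule Weierstrass_m_test')
      fix l y
      assume "y \<in> cball x 1"
      then have "norm y \<le> norm x + 1"
        using norm_triangle_ineq2[of y x] by (simp add: dist_norm norm_minus_commute)
      then show "norm (norm ((1 - q ^ l * y) - 1)) \<le> norm q ^ l * (norm x + 1)"
        by (simp add: norm_mult norm_power mult_left_mono)
    qed (use assms in \<open>simp add: summable_mult2 summable_geometric\<close>)
  qed (auto intro!: continuous_intros)
  then have "uniform_limit (cball x 1) (\<lambda>N x. \<Prod>l<N. 1 - q ^ l * x)
      (\<lambda>x. lim (\<lambda>N. \<Prod>l<N. 1 - q ^ l * x)) sequentially"
    by (rule uniformly_convergent_uniform_limit_iff[THEN iffD1])
  moreover have "lim (\<lambda>N. \<Prod>l<N. 1 - q ^ l * y) = qpoch q y" for y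
  proof (rule limI)
    have "(\<lambda>N. \<Prod>l<Suc N. 1 - q ^ l * y) \<longlonglongrightarrow> qpoch q y"
      using convergent_prod_LIMSEQ[OF convergent_prod_qpoch[OF assms]]
      unfolding qpoch_def lessThan_Suc_atMost by simp
    then show "(\<lambda>N. \<Prod>l<N. 1 - q ^ l * y) \<longlonglongrightarrow> qpoch q y"
      by (rule LIMSEQ_imp_Suc)
  qed
  ultimately show "\<exists>d>0. cball x d \<subseteq> UNIV \<and>
      uniform_limit (cball x d) (\<lambda>n x. \<Prod>l<n. 1 - q ^ l * x) (qpoch q) sequentially"
    by (intro exI[of _ 1]) simp
qed simp

lemma holomorphic_qpoch_comp [holomorphic_intros]:
  assumes "norm q < 1" "f holomorphic_on S"
  shows "(\<lambda>x. qpoch q (f x)) holomorphic_on S"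
  using holomorphic_on_compose[OF assms(2) holomorphic_on_subset[OF holomorphic_qpoch[OF assms(1)]]]
  by (simp add: o_def)

lemma holomorphic_jtheta [holomorphic_intros]:
  assumes "norm q < 1" "f holomorphic_on S" "\<And>x. x \<in> S \<Longrightarrow> f x \<noteq> 0"
  shows "(\<lambda>x. jtheta q (f x)) holomorphic_on S"
  unfolding jtheta_def using assms by (intro holomorphic_intros) auto

text \<open>
  The substitution \<open>x \<mapsto> q x\<close> removes the factor \<open>1 - x\<close> from \<open>qpoch q x\<close> and adds the factor
  \<open>1 - 1 / x\<close> to \<open>qpoch q (q / x)\<close>; the quotient of the two factors is \<open>- 1 / x\<close>.
\<close>

lemma jtheta_q_mult:
  assumes "norm q < 1" "q \<noteq> 0" "x \<noteq> 0"
  shows "jtheta q (q * x) = - jtheta q x / x"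
proof -
  have "x * jtheta q (q * x) = qpoch q q * qpoch q (q * x) * (x * qpoch q (1 / x))"
    using assms by (simp add: jtheta_def)
  also have "x * qpoch q (1 / x) = - ((1 - x) * qpoch q (q / x))"
    using qpoch_rec[OF assms(1), of "1 / x"] assms(3) by (simp add: field_simps)
  also have "qpoch q q * qpoch q (q * x) * (- ((1 - x) * qpoch q (q / x))) = - jtheta q x"
    using qpoch_rec[OF assms(1), of x] by (simp add: jtheta_def)
  finally show ?thesis
    using assms(3) by (simp add: field_simps)
qed

lemma qpoch_nonzero:
  assumes "norm q < 1" "norm x < 1"
  shows "qpoch q x \<noteq> 0"
proof
  assume "qpoch q x = 0"
  then obtain l where "q ^ l * x = 1"
    by (auto simp: qpoch_eq_0_iff[OF assms(1)])
  then have "norm q ^ l * norm x = 1"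
    by (metis norm_mult norm_one norm_power)
  moreover have "norm q ^ l * norm x \<le> 1 * norm x"
    using assms by (intro mult_right_mono power_le_one) auto
  ultimately show False using assms by simp
qed

text \<open>
  The sine contributes the factor \<open>1 - e(v)\<close> that the product over \<open>l \<ge> 1\<close> lacks, and
  the half-integer power \<open>exp (- \<pi> i v)\<close>.
\<close>

lemma theta_eq_jtheta:
  assumes "Im \<tau> > 0"
  shows "theta \<tau> v = \<i> * exp (of_real pi * \<i> * \<tau> / 4) * exp (- (of_real pi * \<i> * v)) * jtheta (ee \<tau>) (ee v)"
proof -
  define q where "q = ee \<tau>"
  have q: "norm q < 1"
    unfolding q_def by (rule norm_ee_less_1[OF assms])
  define x where "x = ee v"
  define e where "e = exp (of_real pi * \<i> * v)"
  have x: "x \<noteq> 0" by (simp add: x_def)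
  have e: "e \<noteq> 0" "x = e ^ 2"
    by (simp_all add: x_def e_def ee_def mult_ac flip: exp_of_nat_mult)
  have "(\<lambda>l. (1 - q ^ l * q) * (1 - q ^ l * (q * x)) * (1 - q ^ l * (q / x))) has_prod
      (qpoch q q * qpoch q (q * x) * qpoch q (q / x))"
    by (intro has_prod_mult qpoch_has_prod q)
  then have 1: "(\<Prod>l. (1 - q ^ Suc l) * (1 - q ^ Suc l * x) * (1 - q ^ Suc l / x)) =
      qpoch q q * qpoch q (q * x) * qpoch q (q / x)"
    using has_prod_unique by (fastforce simp: mult_ac)
  have 2: "2 * sin (of_real pi * v) = \<i> * inverse e * (1 - x)"
  proof -
    have "exp (\<i> * (of_real pi * v)) = e" "exp (- (\<i> * (of_real pi * v))) = inverse e"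
      by (simp_all add: e_def mult_ac flip: exp_minus)
    then show ?thesis
      using e by (simp add: sin_exp_eq field_simps power2_eq_square)
  qed
  have "theta \<tau> v = exp (of_real pi * \<i> * \<tau> / 4) * (2 * sin (of_real pi * v)) *
      (qpoch q q * qpoch q (q * x) * qpoch q (q / x))"
    unfolding theta_def q_def[symmetric] x_def[symmetric] 1 by simp
  also have "\<dots> = \<i> * exp (of_real pi * \<i> * \<tau> / 4) * inverse e * jtheta q x"
    unfolding 2 jtheta_def using qpoch_rec[OF q, of x] by simp
  finally show ?thesis
    by (simp add: e_def exp_minus q_def x_def)
qed

lemma deriv_theta_0:
  assumes "Im \<tau> > 0"
  shows "deriv (theta \<tau>) 0 = 2 * of_real pi * exp (of_real pi * \<i> * \<tau> / 4) * qpoch (ee \<tau>) (ee \<tau>) ^ 3"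
proof (rule DERIV_imp_deriv)
  define q where "q = ee \<tau>"
  have q: "norm q < 1"
    unfolding q_def by (rule norm_ee_less_1[OF assms])
  define R where "R = (\<lambda>v. \<i> * exp (of_real pi * \<i> * \<tau> / 4) * exp (- (of_real pi * \<i> * v)) *
    (qpoch q q * qpoch q (q * ee v) * qpoch q (q / ee v)))"
  have R: "R holomorphic_on UNIV"
    unfolding R_def ee_def using q by (intro holomorphic_intros) auto
  have th: "theta \<tau> v = (1 - ee v) * R v" for v
    using qpoch_rec[OF q, of "ee v"]
    unfolding theta_eq_jtheta[OF assms] R_def jtheta_def q_def by simp
  have "(R has_field_derivative deriv R 0) (at 0)"
    using R by (intro holomorphic_derivI[of _ UNIV]) auto
  then have "((\<lambda>v. (1 - ee v) * R v) has_field_derivative - (2 * of_real pi * \<i>) * R 0) (at 0)"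
    unfolding ee_def by (auto intro!: derivative_eq_intros)
  moreover have "- (2 * of_real pi * \<i>) * R 0 =
      2 * of_real pi * exp (of_real pi * \<i> * \<tau> / 4) * qpoch q q ^ 3"
    by (simp add: R_def ee_def power3_eq_cube)
  ultimately show "(theta \<tau> has_field_derivative 
      2 * of_real pi * exp (of_real pi * \<i> * \<tau> / 4) * qpoch (ee \<tau>) (ee \<tau>) ^ 3) (at 0)"
    unfolding th[abs_def] q_def by (simp only:)
qed

text \<open>
  The factors \<open>exp (- \<pi> i v)\<close> cancel between \<open>theta (a + b)\<close> and \<open>theta a * theta b\<close>, which
  makes the choice of logarithms immaterial.
\<close>

lemma delta_eq_kron:
  assumes "Im \<tau> > 0" "A \<noteq> 0" "B \<noteq> 0"
  shows "delta \<tau> A B = - kron (ee \<tau>) A B"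
proof -
  define a b where "a = lg A" and "b = lg B"
  have ab: "ee a = A" "ee b = B" "ee (a + b) = A * B"
    using assms by (simp_all add: a_def b_def ee_lg) (simp add: ee_def lg_def distrib_left exp_add)
  let ?E = "exp (of_real pi * \<i> * \<tau> / 4)"
  have E: "exp (- (of_real pi * \<i> * (a + b))) = exp (- (of_real pi * \<i> * a)) * exp (- (of_real pi * \<i> * b))"
    by (simp add: distrib_left flip: exp_add)
  show ?thesis
    unfolding delta_def Delta_def a_def[symmetric] b_def[symmetric] kron_def
      theta_eq_jtheta[OF assms(1)] deriv_theta_0[OF assms(1)] ab E
    by (simp add: field_simps)
qed

lemma delta_regular_iff_jtheta:
  assumes "Im \<tau> > 0"
  shows "delta_regular \<tau> A B \<longleftrightarrow> A \<noteq> 0 \<and> B \<noteq> 0 \<and> jtheta (ee \<tau>) A \<noteq> 0 \<and> jtheta (ee \<tau>) B \<noteq> 0"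
  by (auto simp: delta_regular_def theta_eq_jtheta[OF assms] ee_lg)

lemma jtheta_eq_0_iff:
  assumes "Im \<tau> > 0" "x \<noteq> 0"
  shows "jtheta (ee \<tau>) x = 0 \<longleftrightarrow> (\<exists>m::int. x = ee \<tau> powi m)"
  using theta_eq_0_iff[OF assms(1), of "lg x"] assms(2) by (simp add: theta_eq_jtheta[OF assms(1)] ee_lg)

section \<open>Kronecker's expansion\<close>

lemma norm_ee: "norm (ee z) = exp (- (2 * pi * Im z))"
  by (simp add: ee_def norm_exp_eq_Re)

text \<open>
  The Liouville argument. The factor \<open>e(r b)\<close> with \<open>r = Im a / Im \<tau>\<close> is chosen so that
  multiplying \<open>h\<close> by it cancels the modulus of the multiplier \<open>1 / e(a)\<close> while the period 1
  only introduces a phase. The modulus of the product is then doubly periodic, so it is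
  maximal at a point of a compact fundamental domain and the product is constant. Since
  \<open>0 < r < 1\<close>, the phase \<open>e(r)\<close> is not 1, and the constant is 0.
\<close>

lemma quasi_periodic_strip_eq_0:
  fixes h :: "complex \<Rightarrow> complex" and \<tau> :: complex
  defines "S \<equiv> {b. - Im \<tau> < Im b \<and> Im b < Im \<tau>}"
  assumes hol: "h holomorphic_on S" and \<tau>: "Im \<tau> > 0"
    and per1: "\<And>b. b \<in> S \<Longrightarrow> h (b + 1) = h b"
    and per\<tau>: "\<And>b. - Im \<tau> < Im b \<Longrightarrow> Im b < 0 \<Longrightarrow> h (b + \<tau>) = h b / ee a"
    and a: "0 < Im a" "Im a < Im \<tau>"
    and b: "b \<in> S"
  shows "h b = 0"
proof -
  define r where "r = Im a / Im \<tau>"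
  have r: "0 < r" "r < 1"
    using a \<tau> by (simp_all add: r_def)
  define K where "K = (\<lambda>b. ee (of_real r * b) * h b)"
  have K1: "K (b + 1) = ee (of_real r) * K b" if "b \<in> S" for b
    using per1[OF that] by (simp add: K_def ee_def distrib_left exp_add)
  have norm1: "norm (K (b + 1)) = norm (K b)" if "b \<in> S" for b
    using K1[OF that] by (simp add: norm_mult norm_ee)
  have norm\<tau>: "norm (K (b + \<tau>)) = norm (K b)" if "- Im \<tau> < Im b" "Im b < 0" for b
  proof -
    have "norm (ee (of_real r * (b + \<tau>))) = norm (ee (of_real r * b)) * norm (ee a)"
      using \<tau> by (simp add: norm_ee r_def field_simps flip: exp_add)
    then show ?thesis
      using per\<tau>[OF that] by (simp add: K_def norm_mult norm_divide)
  qed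
  have normint: "norm (K (b + of_int m)) = norm (K b)" if "b \<in> S" for b m
  proof (induction m rule: int_induct [where k = 0])
    case (step1 i)
    have "b + of_int i \<in> S" using that by (simp add: S_def)
    from norm1[OF this] step1 show ?case by (simp add: add_ac)
  next
    case (step2 i)
    have "b + of_int (i - 1) \<in> S" using that by (simp add: S_def)
    from norm1[OF this] step2 show ?case by simp
  qed simp
  define C where "C = cbox (Complex 0 (- Im \<tau> / 2)) (Complex 1 (Im \<tau> / 2))"
  have C: "b \<in> C \<longleftrightarrow> 0 \<le> Re b \<and> Re b \<le> 1 \<and> - Im \<tau> / 2 \<le> Im b \<and> Im b \<le> Im \<tau> / 2" for b
    by (simp add: C_def in_cbox_complex_iff)
  have CS: "C \<subseteq> S"
    using \<tau> by (auto simp: C S_def)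
  have Khol: "K holomorphic_on S"
    unfolding K_def ee_def using hol by (intro holomorphic_intros) auto
  have "Complex 0 0 \<in> C"
    using \<tau> by (simp add: C)
  then have "\<exists>\<xi>\<in>C. \<forall>z\<in>C. norm (K z) \<le> norm (K \<xi>)"
    using Khol CS
    by (intro continuous_attains_sup continuous_on_norm)
       (auto simp: C_def intro: holomorphic_on_imp_continuous_on continuous_on_subset)
  then obtain \<xi> where \<xi>: "\<xi> \<in> C" "\<And>z. z \<in> C \<Longrightarrow> norm (K z) \<le> norm (K \<xi>)"
    by blast
  have max0: "norm (K z) \<le> norm (K \<xi>)" if "- Im \<tau> / 2 \<le> Im z" "Im z \<le> Im \<tau> / 2" for z
  proof -
    have zS: "z \<in> S" using that \<tau> by (auto simp: S_def)
    have "z + of_int (- \<lfloor>Re z\<rfloor>) \<in> C"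
      using that by (simp add: C) linarith
    from \<xi>(2)[OF this] show ?thesis
      unfolding normint[OF zS] .
  qed
  have max: "norm (K z) \<le> norm (K \<xi>)" if "z \<in> S" for z
  proof -
    consider "Im z > Im \<tau> / 2" | "Im z < - Im \<tau> / 2" | "- Im \<tau> / 2 \<le> Im z" "Im z \<le> Im \<tau> / 2"
      by linarith
    then show ?thesis
    proof cases
      case 1
      then show ?thesis
        using norm\<tau>[of "z - \<tau>"] max0[of "z - \<tau>"] that by (auto simp: S_def)
    next
      case 2
      then show ?thesis
        using norm\<tau>[of z] max0[of "z + \<tau>"] that \<tau> by (auto simp: S_def)
    qed (rule max0)
  qed
  have S_eq: "S = {b. Im b > - Im \<tau>} \<inter> {b. Im b < Im \<tau>}"
    by (auto simp: S_def)
  have "K constant_on S"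
  proof (rule maximum_modulus_principle[OF Khol _ _ _ subset_refl _ max])
    show "open S"
      unfolding S_eq by (intro open_Int open_halfspace_Im_gt open_halfspace_Im_lt)
    then show "open S" .
    show "connected S"
      unfolding S_eq
      by (intro convex_connected convex_Int convex_halfspace_Im_gt convex_halfspace_Im_lt)
    show "\<xi> \<in> S" using \<xi> CS by blast
  qed
  then obtain c where c: "K z = c" if "z \<in> S" for z
    unfolding constant_on_def by blast
  have "b + 1 \<in> S" using b by (simp add: S_def)
  then have "ee (of_real r) * c = c"
    using K1[OF b] c b by simp
  moreover have "ee (of_real r) \<noteq> ee 0"
  proof
    assume "ee (of_real r) = ee 0"
    then obtain m :: int where "complex_of_real r = of_int m"
      by (auto simp: ee_eq_iff)
    then have "r = of_int m"
      by (metis of_real_eq_iff of_real_of_int_eq)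
    with r show False by auto
  qed
  ultimately have "c = 0"
    by (simp add: ee_def)
  with c[OF b] show ?thesis
    by (simp add: K_def)
qed

definition kterm :: "complex \<Rightarrow> complex \<Rightarrow> complex \<Rightarrow> int \<Rightarrow> complex" where
  "kterm q A B n = A powi n / (1 - B * q powi n)"

lemma has_sum_int_split:
  fixes f :: "int \<Rightarrow> 'a :: {topological_comm_monoid_add, t3_space}"
  assumes "((\<lambda>m. f (int (Suc m))) has_sum s) UNIV"
    and "((\<lambda>m. f (- int (Suc m))) has_sum s') UNIV"
  shows "(f has_sum (f 0 + s + s')) UNIV"
proof -
  have "((\<lambda>m. f (int (Suc m))) has_sum s) UNIV = (f has_sum s) {1..}"
    by (rule has_sum_reindex_bij_witness[where j = "\<lambda>m. int (Suc m)" and i = "\<lambda>n. nat n - 1"]) auto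
  with assms(1) have "(f has_sum s) {1..}" by simp
  moreover have "((\<lambda>m. f (- int (Suc m))) has_sum s') UNIV = (f has_sum s') {..-1}"
    by (rule has_sum_reindex_bij_witness[where j = "\<lambda>m. - int (Suc m)" and i = "\<lambda>n. nat (- n) - 1"]) auto
  with assms(2) have "(f has_sum s') {..-1}" by simp
  moreover have "(f has_sum f 0) {0}"
    by (intro has_sum_finiteI) auto
  ultimately have "(f has_sum (f 0 + s + s')) ({0} \<union> {1..} \<union> {..-1})"
    by (intro has_sum_Un_disjoint) auto
  moreover have "{0} \<union> {1..} \<union> {..-1} = (UNIV :: int set)"
    by auto
  ultimately show ?thesis by simp
qed

text \<open>
  The sum of the terms with positive index. The terms with negative index are of the same kind,
  with \<open>q / A\<close> and \<open>1 / B\<close> in place of \<open>A\<close> and \<open>B\<close> (lemma \<open>kterm_neg\<close>), so the analysis is needed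
  for one half only.
\<close>

definition khalf :: "complex \<Rightarrow> complex \<Rightarrow> complex \<Rightarrow> complex" where
  "khalf q A B = (\<Sum>m. A ^ Suc m / (1 - B * q ^ Suc m))"

lemma khalf_bound:
  fixes q A B :: complex
  assumes "norm q < 1" "norm B * norm q \<le> r" "r < 1"
  shows "norm (A ^ Suc m / (1 - B * q ^ Suc m)) \<le> norm A ^ Suc m / (1 - r)"
proof -
  have "norm (B * q ^ Suc m) = norm B * norm q * norm q ^ m"
    by (simp add: norm_mult norm_power)
  also have "\<dots> \<le> norm B * norm q * 1"
    using assms by (intro mult_left_mono power_le_one) auto
  also have "\<dots> \<le> r" using assms by simp
  finally have "1 - r \<le> norm (1 - B * q ^ Suc m)"
    using norm_triangle_ineq2[of 1 "B * q ^ Suc m"] by simp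
  then show ?thesis
    using assms unfolding norm_divide norm_power by (intro frac_le) auto
qed

lemma khalf_summable:
  fixes q A B :: complex
  assumes "norm q < 1" "norm B * norm q < 1" "norm A < 1"
  shows "summable (\<lambda>m. norm (A ^ Suc m / (1 - B * q ^ Suc m)))"
proof (rule summable_comparison_test')
  show "summable (\<lambda>m. norm A ^ Suc m / (1 - norm B * norm q))"
    using assms by (intro summable_divide) (simp add: summable_geometric summable_mult)
  show "norm (norm (A ^ Suc m / (1 - B * q ^ Suc m))) \<le> norm A ^ Suc m / (1 - norm B * norm q)" for m
    using khalf_bound[OF assms(1) order.refl assms(2)] by simp
qed

text \<open>
  The nearest pole of a term with positive index is \<open>1 / q\<close>. Hence on the annulus
  \<open>|q| < |B| < 1/|q|\<close> the only pole of the whole Kronecker series is that of the term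
  of index 0, at \<open>B = 1\<close>.
\<close>

lemma holomorphic_khalf:
  assumes "norm q < 1" "q \<noteq> 0" "norm A < 1"
  shows "khalf q A holomorphic_on ball 0 (1 / norm q)"
proof (rule holomorphic_uniform_sequence)
  have ne: "1 - B * q ^ Suc m \<noteq> 0" if "B \<in> ball 0 (1 / norm q)" for B m
  proof
    assume "1 - B * q ^ Suc m = 0"
    then have "norm (B * q ^ Suc m) = 1" by (metis norm_one right_minus_eq)
    then have "norm B * norm q * norm q ^ m = 1"
      by (simp add: norm_mult norm_power)
    moreover have "norm B * norm q * norm q ^ m \<le> norm B * norm q * 1"
      using assms by (intro mult_left_mono power_le_one) auto
    ultimately show False
      using that assms by (simp add: field_simps)
  qed
  then show "(\<lambda>B. \<Sum>m<n. A ^ Suc m / (1 - B * q ^ Suc m)) holomorphic_on ball 0 (1 / norm q)" for n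
    by (intro holomorphic_intros) auto
  fix x assume "x \<in> ball (0::complex) (1 / norm q)"
  then obtain d where d: "d > 0" "cball x d \<subseteq> ball 0 (1 / norm q)"
    using open_contains_cball[of "ball (0::complex) (1 / norm q)"] by blast
  \<comment> \<open>The closed disc about \<open>x\<close> reaches out to modulus \<open>norm x + d\<close>, so that circle is still inside the ball.\<close>
  have R: "(norm x + d) * norm q < 1"
  proof -
    define y where "y = (if x = 0 then of_real d else x + of_real d * sgn x)"
    have "y \<in> cball x d"
      using d by (simp add: y_def dist_norm norm_mult norm_sgn)
    then have "norm y < 1 / norm q" using d by auto
    moreover have "y = of_real (norm x + d) * (if x = 0 then 1 else sgn x)"
      by (simp add: y_def sgn_eq field_simps)
    then have "norm y = norm x + d"
      using d by (simp only: norm_mult norm_of_real) (simp add: norm_sgn)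
    ultimately show ?thesis
      using assms by (simp add: field_simps)
  qed
  have "uniform_limit (cball x d) (\<lambda>n B. \<Sum>m<n. A ^ Suc m / (1 - B * q ^ Suc m)) (khalf q A) sequentially"
    unfolding khalf_def
  proof (rule Weierstrass_m_test)
    fix m y assume "y \<in> cball x d"
    then have "norm y \<le> norm x + d"
      using norm_triangle_ineq2[of y x] by (simp add: dist_norm norm_minus_commute)
    then have "norm y * norm q \<le> (norm x + d) * norm q"
      by (simp add: mult_right_mono)
    then show "norm (A ^ Suc m / (1 - y * q ^ Suc m)) \<le> norm A ^ Suc m / (1 - (norm x + d) * norm q)"
      using R assms by (intro khalf_bound) auto
  next
    show "summable (\<lambda>m. norm A ^ Suc m / (1 - (norm x + d) * norm q))"
      using assms by (intro summable_divide) (simp add: summable_geometric summable_mult)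
  qed
  then show "\<exists>d>0. cball x d \<subseteq> ball 0 (1 / norm q) \<and>
      uniform_limit (cball x d) (\<lambda>n B. \<Sum>m<n. A ^ Suc m / (1 - B * q ^ Suc m)) (khalf q A) sequentially"
    using d by blast
qed simp

lemma kterm_neg:
  assumes "q \<noteq> 0" "A \<noteq> 0" "B \<noteq> 0"
  shows "kterm q A B (- int (Suc m)) = - (1 / B) * ((q / A) ^ Suc m / (1 - 1 / B * q ^ Suc m))"
proof (cases "B = q ^ Suc m")
  case True
  then show ?thesis
    using assms by (simp add: kterm_def power_int_minus del: of_nat_Suc power_Suc)
next
  case False
  then have "1 - B * inverse (q ^ Suc m) \<noteq> 0" "1 - 1 / B * q ^ Suc m \<noteq> 0"
    using assms by (simp_all add: field_simps del: power_Suc)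
  then show ?thesis
    using assms
    by (simp add: kterm_def power_int_minus power_divide divide_simps del: of_nat_Suc power_Suc)
       (simp add: algebra_simps del: power_Suc)
qed

lemma kterm_has_sum_annulus:
  assumes q: "norm q < 1" "q \<noteq> 0" and A: "norm q < norm A" "norm A < 1"
    and B: "norm q < norm B" "norm B * norm q < 1"
  defines "s \<equiv> 1 / (1 - B) + khalf q A B - 1 / B * khalf q (q / A) (1 / B)"
  shows "(kterm q A B has_sum s) UNIV" "(\<lambda>n. norm (kterm q A B n)) summable_on UNIV"
proof -
  have nz: "A \<noteq> 0" "B \<noteq> 0" using A B by auto
  have qA: "norm (q / A) < 1" "norm (1 / B) * norm q < 1"
    using A B nz by (simp_all add: norm_divide)
  note S1 = khalf_summable[OF q(1) B(2) A(2)]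
  note S2 = khalf_summable[OF q(1) qA(2) qA(1)]
  have pos: "kterm q A B (int (Suc m)) = A ^ Suc m / (1 - B * q ^ Suc m)" for m
    by (simp add: kterm_def del: of_nat_Suc power_Suc)
  have "((\<lambda>m. kterm q A B (int (Suc m))) has_sum khalf q A B) UNIV"
    unfolding pos khalf_def
    by (rule norm_summable_imp_has_sum[OF S1 summable_sums[OF summable_norm_cancel[OF S1]]])
  moreover have "((\<lambda>m. kterm q A B (- int (Suc m))) has_sum (- (1 / B) * khalf q (q / A) (1 / B))) UNIV"
    unfolding kterm_neg[OF q(2) nz] khalf_def
    by (intro has_sum_cmult_right)
       (rule norm_summable_imp_has_sum[OF S2 summable_sums[OF summable_norm_cancel[OF S2]]])
  ultimately have "(kterm q A B has_sum (kterm q A B 0 + khalf q A B + - (1 / B) * khalf q (q / A) (1 / B))) UNIV"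
    by (rule has_sum_int_split)
  then show "(kterm q A B has_sum s) UNIV"
    by (simp add: s_def kterm_def)
  from S1 have "summable (\<lambda>m. norm (norm (kterm q A B (int (Suc m)))))"
    unfolding pos by simp
  then obtain s1 where "((\<lambda>m. norm (kterm q A B (int (Suc m)))) has_sum s1) UNIV"
    using norm_summable_imp_summable_on[of "\<lambda>m. norm (kterm q A B (int (Suc m)))"] by (auto simp: summable_on_def)
  moreover have "summable (\<lambda>m. norm (1 / B) * norm ((q / A) ^ Suc m / (1 - 1 / B * q ^ Suc m)))"
    by (rule summable_mult[OF S2])
  then have "summable (\<lambda>m. norm (norm (kterm q A B (- int (Suc m)))))"
    unfolding kterm_neg[OF q(2) nz] by (simp only: norm_mult norm_minus_cancel abs_norm_cancel real_norm_def abs_mult)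
  then obtain s2 where "((\<lambda>m. norm (kterm q A B (- int (Suc m)))) has_sum s2) UNIV"
    using norm_summable_imp_summable_on[of "\<lambda>m. norm (kterm q A B (- int (Suc m)))"] by (auto simp: summable_on_def)
  ultimately show "(\<lambda>n. norm (kterm q A B n)) summable_on UNIV"
    using has_sum_int_split[of "\<lambda>n. norm (kterm q A B n)"] by (blast intro: has_sum_imp_summable)
qed

lemma kterm_shift:
  assumes "q \<noteq> 0" "A \<noteq> 0"
  shows "kterm q A (q * B) n = kterm q A B (n + 1) / A"
  using assms by (simp add: kterm_def power_int_add mult_ac)

lemma kterm_has_sum_shift:
  assumes "q \<noteq> 0" "A \<noteq> 0"
  shows "(kterm q A (q * B) has_sum s) UNIV \<longleftrightarrow> (kterm q A B has_sum (s * A)) UNIV"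
proof -
  have "(kterm q A (q * B) has_sum s) UNIV \<longleftrightarrow> ((\<lambda>n. kterm q A (q * B) n * A) has_sum (s * A)) UNIV"
    using assms by (simp add: has_sum_cmult_left_iff)
  also have "(\<lambda>n. kterm q A (q * B) n * A) = (\<lambda>n. kterm q A B (n + 1))"
    using assms by (simp add: kterm_shift)
  also have "(\<dots> has_sum (s * A)) UNIV \<longleftrightarrow> (kterm q A B has_sum (s * A)) UNIV"
    by (rule has_sum_reindex_bij_witness[where j = "\<lambda>n. n + 1" and i = "\<lambda>n. n - 1"]) auto
  finally show ?thesis .
qed

lemma kterm_abs_summable_shift:
  assumes "q \<noteq> 0" "A \<noteq> 0"
  shows "(\<lambda>n. norm (kterm q A (q * B) n)) summable_on UNIV \<longleftrightarrow> (\<lambda>n. norm (kterm q A B n)) summable_on UNIV"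
proof -
  have "(\<lambda>n. norm (kterm q A (q * B) n)) summable_on UNIV \<longleftrightarrow> (\<lambda>n. norm (kterm q A B (n + 1)) * norm (1 / A)) summable_on UNIV"
    using assms by (simp add: kterm_shift norm_divide)
  also have "\<dots> \<longleftrightarrow> (\<lambda>n. norm (kterm q A B (n + 1))) summable_on UNIV"
    using assms by (subst summable_on_cmult_left') auto
  also have "\<dots> \<longleftrightarrow> (\<lambda>n. norm (kterm q A B n)) summable_on UNIV"
    by (rule summable_on_reindex_bij_witness[where j = "\<lambda>n. n + 1" and i = "\<lambda>n. n - 1"]) auto
  finally show ?thesis .
qed

lemma kron_shift:
  assumes "norm q < 1" "q \<noteq> 0" "A \<noteq> 0" "B \<noteq> 0"
  shows "kron q A (q * B) = kron q A B / A"
  using jtheta_q_mult[OF assms(1,2), of "A * B"] jtheta_q_mult[OF assms(1,2), of B] assms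
  by (simp add: kron_def mult_ac)

text \<open>
  Only the pole at \<open>B = 1\<close> has to be compared. Writing \<open>jtheta q B = (1 - B) R B\<close> turns
  \<open>kron q A B\<close> into \<open>N B / (1 - B)\<close> with \<open>N 1 = 1\<close>, which matches the term \<open>1 / (1 - B)\<close> of index 0.
  The difference is the difference quotient \<open>M\<close> of \<open>N\<close>, whose singularity is removable,
  plus the two holomorphic half sums.
\<close>

lemma kronecker_annulus:
  assumes \<tau>: "Im \<tau> > 0" and a: "0 < Im a" "Im a < Im \<tau>"
    and b: "- Im \<tau> < Im b" "Im b < Im \<tau>" and b1: "ee b \<noteq> 1"
  shows "(kterm (ee \<tau>) (ee a) (ee b) has_sum kron (ee \<tau>) (ee a) (ee b)) UNIV"
proof -
  define q A where "q = ee \<tau>" and "A = ee a"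
  have q: "norm q < 1" "q \<noteq> 0"
    using \<tau> by (simp_all add: q_def norm_ee_less_1)
  have A: "norm q < norm A" "norm A < 1" "A \<noteq> 0"
    using a by (simp_all add: q_def A_def norm_ee)
  define D where "D = {B :: complex. norm q < norm B \<and> norm B * norm q < 1}"
  have D_ee: "ee b \<in> D \<longleftrightarrow> - Im \<tau> < Im b \<and> Im b < Im \<tau>" for b
  proof -
    have "norm (ee b) * norm q = norm (ee (b + \<tau>))"
      by (simp add: q_def norm_ee algebra_simps flip: exp_add)
    also have "\<dots> < 1 \<longleftrightarrow> 0 < Im b + Im \<tau>"
      by (simp add: norm_ee zero_less_mult_iff)
    finally show ?thesis
      by (auto simp: D_def q_def norm_ee)
  qed
  have D0: "B \<noteq> 0" if "B \<in> D" for B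
    using that q by (auto simp: D_def)
  have jA: "jtheta q A \<noteq> 0"
    using A q by (simp add: jtheta_def qpoch_nonzero norm_divide)
  define R where "R = (\<lambda>B. qpoch q q * qpoch q (q * B) * qpoch q (q / B))"
  have jt: "jtheta q B = (1 - B) * R B" for B
    using qpoch_rec[OF q(1), of B] by (simp add: jtheta_def R_def)
  have R0: "R B \<noteq> 0" if "B \<in> D" for B
    using that q D0[OF that] by (simp add: R_def qpoch_nonzero norm_divide norm_mult D_def mult.commute)
  define N where "N = (\<lambda>B. qpoch q q ^ 3 * jtheta q (A * B) / (jtheta q A * R B))"
  have N_hol: "N holomorphic_on D"
    unfolding N_def R_def using q(1) A(3) D0 jA R0[unfolded R_def]
    by (intro holomorphic_intros) auto
  have "R 1 = qpoch q q ^ 3" by (simp add: R_def power3_eq_cube)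
  then have N1: "N 1 = 1"
    using jA qpoch_nonzero[OF q(1) q(1)] by (simp add: N_def)
  define M where "M = (\<lambda>B. if B = 1 then deriv N 1 else (N B - N 1) / (B - 1))"
  have "D = - cball 0 (norm q) \<inter> ball 0 (1 / norm q)"
    using q by (auto simp: D_def field_simps)
  then have "open D" by (simp add: open_Int open_Compl)
  then have M_hol: "M holomorphic_on D"
    unfolding M_def using N_hol by (intro pole_lemma_open)
  define H where "H = (\<lambda>B. khalf q A B - 1 / B * khalf q (q / A) (1 / B) + M B)"
  have kh: "(\<lambda>B. khalf q A' (f B)) holomorphic_on D" if "norm A' < 1" "f holomorphic_on D"
    "\<And>B. B \<in> D \<Longrightarrow> f B \<in> ball 0 (1 / norm q)" for f A'
    using holomorphic_on_compose[OF that(2) holomorphic_on_subset[OF holomorphic_khalf[OF q that(1)]]] that(3)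
    by (simp add: o_def image_subset_iff)
  have H_hol: "H holomorphic_on D"
    unfolding H_def using A q D0 
    by (intro holomorphic_intros kh M_hol) (auto simp: norm_divide D_def field_simps)
  have sum_H: "(kterm q A B has_sum (H B + kron q A B)) UNIV" if "B \<in> D" "B \<noteq> 1" for B
  proof -
    have B: "norm q < norm B" "norm B * norm q < 1" using that by (auto simp: D_def)
    have "kron q A B = N B / (1 - B)"
      using that jA R0[OF that(1)] by (simp add: kron_def jt[of B] N_def)
    moreover have "M B = 1 / (1 - B) - N B / (1 - B)"
      using that by (simp add: M_def N1 divide_simps) (simp add: algebra_simps)
    ultimately have "H B + kron q A B = 1 / (1 - B) + khalf q A B - 1 / B * khalf q (q / A) (1 / B)"
      by (simp add: H_def)
    then show ?thesis
      using kterm_has_sum_annulus(1)[OF q A(1,2) B] by simp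
  qed
  have "H (ee b) = 0"
  proof (rule quasi_periodic_strip_eq_0[where h = "\<lambda>b. H (ee b)" and \<tau> = \<tau> and a = a])
    show "(\<lambda>b. H (ee b)) holomorphic_on {b. - Im \<tau> < Im b \<and> Im b < Im \<tau>}"
    proof -
      have "ee holomorphic_on {b. - Im \<tau> < Im b \<and> Im b < Im \<tau>}"
        unfolding ee_def[abs_def] by (intro holomorphic_intros)
      from holomorphic_on_compose[OF this holomorphic_on_subset[OF H_hol]] show ?thesis
        by (simp add: o_def D_ee image_subset_iff)
    qed
  next
    fix b assume b: "- Im \<tau> < Im b" "Im b < 0"
    have D: "ee b \<in> D" "ee (b + \<tau>) \<in> D" using b \<tau> by (auto simp: D_ee)
    have eq: "ee (b + \<tau>) = q * ee b" by (simp add: ee_def q_def distrib_left exp_add)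
    have "norm (ee b) \<noteq> 1" "norm (ee (b + \<tau>)) \<noteq> 1"
      using b by (simp_all add: norm_ee)
    then have ne: "ee b \<noteq> 1" "ee (b + \<tau>) \<noteq> 1" by auto
    have "(kterm q A (ee b) has_sum ((H (ee (b + \<tau>)) + kron q A (ee (b + \<tau>))) * A)) UNIV"
      using sum_H[OF D(2) ne(2)] kterm_has_sum_shift[OF q(2) A(3)] unfolding eq by blast
    with sum_H[OF D(1) ne(1)] have "H (ee b) + kron q A (ee b) = (H (ee (b + \<tau>)) + kron q A (ee (b + \<tau>))) * A"
      using has_sum_unique by blast
    also have "kron q A (ee (b + \<tau>)) = kron q A (ee b) / A"
      unfolding eq by (rule kron_shift) (use q A in auto)
    finally show "H (ee (b + \<tau>)) = H (ee b) / ee a"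
      using A(3) by (simp add: A_def field_simps)
  qed (use \<tau> a b in auto)
  with sum_H[of "ee b"] b b1 show ?thesis
    by (simp add: D_ee q_def A_def)
qed

text \<open>
  Both sides obey the same rule under \<open>B \<mapsto> q B\<close>, so every \<open>B\<close> can be moved into
  the annulus \<open>|q| < |B| \<le> 1\<close>.
\<close>

theorem kronecker:
  assumes \<tau>: "Im \<tau> > 0" and q: "q = ee \<tau>"
    and A: "norm q < norm A" "norm A < 1"
    and B: "B \<noteq> 0" "jtheta q B \<noteq> 0"
  shows "(kterm q A B has_sum kron q A B) UNIV" "(\<lambda>n. norm (kterm q A B n)) summable_on UNIV"
proof -
  have q': "norm q < 1" "q \<noteq> 0"
    using \<tau> by (simp_all add: q norm_ee_less_1)
  have A0: "A \<noteq> 0" using A by auto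
  define a where "a = lg A"
  have Aa: "A = ee a" using A0 by (simp add: a_def ee_lg)
  have a: "0 < Im a" "Im a < Im \<tau>"
    using A by (simp_all add: Aa q norm_ee zero_less_mult_iff)
  define P where "P = (\<lambda>B. jtheta q B \<noteq> 0 \<longrightarrow> (kterm q A B has_sum kron q A B) UNIV \<and>
    (\<lambda>n. norm (kterm q A B n)) summable_on UNIV)"
  have shift: "P (ee (b + \<tau>)) \<longleftrightarrow> P (ee b)" for b
  proof -
    have "ee (b + \<tau>) = q * ee b" by (simp add: ee_def q distrib_left exp_add)
    then show ?thesis
      using q' A0 jtheta_q_mult[OF q', of "ee b"]
      by (simp add: P_def kterm_has_sum_shift kterm_abs_summable_shift kron_shift)
  qed
  have shifts: "P (ee (b + of_int m * \<tau>)) \<longleftrightarrow> P (ee b)" for b m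
  proof (induction m rule: int_induct [where k = 0])
    case (step1 i)
    then show ?case using shift[of "b + of_int i * \<tau>"] by (simp add: algebra_simps)
  next
    case (step2 i)
    then show ?case using shift[of "b + of_int (i - 1) * \<tau>"] by (simp add: algebra_simps)
  qed simp
  define b m where "b = lg B" and "m = - \<lfloor>Im b / Im \<tau>\<rfloor>"
  define b' where "b' = b + of_int m * \<tau>"
  have b': "0 \<le> Im b'" "Im b' < Im \<tau>"
    using floor_divide_lower[OF \<tau>, of "Im b"] floor_divide_upper[OF \<tau>, of "Im b"]
    by (simp_all add: b'_def m_def algebra_simps)
  have "P (ee b')"
  proof -
    have "ee b' \<noteq> 1" if "jtheta q (ee b') \<noteq> 0"
      using that qpoch_rec[OF q'(1), of 1] by (auto simp: jtheta_def)
    moreover have "norm q < norm (ee b')" "norm (ee b') * norm q < 1"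
    proof -
      show "norm q < norm (ee b')" using b' by (simp add: q norm_ee)
      have "norm (ee b') * norm q \<le> 1 * norm q"
        using b' by (intro mult_right_mono) (auto simp: norm_ee)
      with q'(1) show "norm (ee b') * norm q < 1" by linarith
    qed
    ultimately show ?thesis
      using kronecker_annulus[OF \<tau> a, of b'] kterm_has_sum_annulus(2)[OF q' A, of "ee b'"] b' \<tau>
      by (auto simp: P_def q[symmetric] Aa[symmetric])
  qed
  moreover have "B = ee b" using B by (simp add: b_def ee_lg)
  ultimately have "P B" using shifts[of b m] by (simp add: b'_def)
  with B show "(kterm q A B has_sum kron q A B) UNIV" "(\<lambda>n. norm (kterm q A B n)) summable_on UNIV"
    by (simp_all add: P_def)
qed

section \<open>Auxiliary sums\<close>

lemma has_sum_sum:
  fixes f :: "'i \<Rightarrow> 'x \<Rightarrow> 'a :: topological_comm_monoid_add"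
  assumes "finite I" "\<And>i. i \<in> I \<Longrightarrow> (f i has_sum s i) X"
  shows "((\<lambda>x. \<Sum>i\<in>I. f i x) has_sum (\<Sum>i\<in>I. s i)) X"
  using assms by (induction I rule: finite_induct) (auto intro!: has_sum_add)

lemma has_sum_product:
  fixes f :: "'x \<Rightarrow> complex" and g :: "'y \<Rightarrow> complex"
  assumes f: "(f has_sum F) UNIV" "(\<lambda>x. norm (f x)) summable_on UNIV"
    and g: "(g has_sum G) UNIV" "(\<lambda>x. norm (g x)) summable_on UNIV"
  shows "((\<lambda>(x, y). f x * g y) has_sum (F * G)) UNIV"
proof -
  have "((\<lambda>(x, y). f x * g y) has_sum (F * G)) (UNIV \<times> UNIV)"
  proof (rule has_sum_SigmaI)
    show "((\<lambda>y. case (x, y) of (x, y) \<Rightarrow> f x * g y) has_sum f x * G) UNIV" for x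
      using has_sum_cmult_right[OF g(1)] by simp
    show "((\<lambda>x. f x * G) has_sum (F * G)) UNIV"
      by (rule has_sum_cmult_left[OF f(1)])
    have "(\<lambda>p. norm (case p of (x, y) \<Rightarrow> f x * g y)) summable_on (UNIV \<times> UNIV)"
    proof (rule summable_on_SigmaI)
      show "((\<lambda>y. norm (case (x, y) of (x, y) \<Rightarrow> f x * g y)) has_sum
          norm (f x) * infsum (\<lambda>y. norm (g y)) UNIV) UNIV" for x
        using has_sum_cmult_right[OF has_sum_infsum[OF g(2)]] by (simp add: norm_mult)
      show "(\<lambda>x. norm (f x) * infsum (\<lambda>y. norm (g y)) UNIV) summable_on UNIV"
        by (rule summable_on_cmult_left[OF f(2)])
    qed auto
    then show "(\<lambda>(x, y). f x * g y) summable_on (UNIV \<times> UNIV)"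
      by (rule abs_summable_summable)
  qed
  then show ?thesis by simp
qed

text \<open>
  For \<open>z \<noteq> 1\<close> and \<open>X \<noteq> 0\<close> this telescopes, because \<open>X (z - 1)\<close> times the \<open>j\<close>-th summand is
  \<open>1 / (1 - X z\<^sup>j\<^sup>+\<^sup>1) - 1 / (1 - X z\<^sup>j)\<close>. Keeping the geometric sum on the right undivided
  covers \<open>z = 1\<close> too, which does occur: \<open>z = (\<mu>2 / \<mu>1) q\<^sup>c\<close> may be 1.
\<close>

lemma sum_geometric_telescope:
  fixes X z :: "'a :: field"
  assumes "\<And>j. j \<le> n \<Longrightarrow> 1 - X * z ^ j \<noteq> 0"
  shows "(\<Sum>j<n. z ^ j / ((1 - X * z ^ j) * (1 - X * z ^ Suc j))) = (\<Sum>l<n. z ^ l) / ((1 - X) * (1 - X * z ^ n))"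
  using assms
proof (induction n)
  case (Suc n)
  define G where "G = (\<Sum>l<n. z ^ l)"
  have nz: "1 - X \<noteq> 0" "1 - X * z ^ n \<noteq> 0" "1 - X * z ^ Suc n \<noteq> 0"
    using Suc.prems[of 0] Suc.prems[of n] Suc.prems[of "Suc n"] by simp_all
  have "G * (1 - z) = 1 - z ^ n"
    unfolding G_def by (simp add: one_diff_power_eq mult.commute)
  then have geo: "z ^ n = 1 - G * (1 - z)" by simp
  have "(\<Sum>j<Suc n. z ^ j / ((1 - X * z ^ j) * (1 - X * z ^ Suc j))) =
      G / ((1 - X) * (1 - X * z ^ n)) + z ^ n / ((1 - X * z ^ n) * (1 - X * z ^ Suc n))"
    using Suc by (simp add: G_def)
  also have "\<dots> = (G * (1 - X * z ^ Suc n) + z ^ n * (1 - X)) / ((1 - X) * (1 - X * z ^ n) * (1 - X * z ^ Suc n))"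
    using nz by (simp add: divide_simps del: power_Suc)
  also have "G * (1 - X * z ^ Suc n) + z ^ n * (1 - X) = (G + z ^ n) * (1 - X * z ^ n)"
    unfolding power_Suc geo by (simp add: algebra_simps)
  also have "\<dots> / ((1 - X) * (1 - X * z ^ n) * (1 - X * z ^ Suc n)) = (G + z ^ n) / ((1 - X) * (1 - X * z ^ Suc n))"
    using nz by (simp del: power_Suc)
  finally show ?case by (simp add: G_def)
qed simp

lemma kron_commute: "kron q A B = kron q B A"
  by (simp add: kron_def mult_ac)

lemma kron_shift_power:
  assumes "norm q < 1" "q \<noteq> 0" "A \<noteq> 0" "B \<noteq> 0"
  shows "kron q (q ^ j * A) B = kron q A B / B ^ j"
proof (induction j)
  case (Suc j)
  have "kron q (q ^ Suc j * A) B = kron q B (q * (q ^ j * A))"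
    by (simp add: kron_commute mult_ac)
  also have "\<dots> = kron q (q ^ j * A) B / B"
    using assms by (subst kron_shift) (simp_all add: kron_commute)
  finally show ?case by (simp add: Suc)
qed simp

lemma sum_roots_of_unity:
  assumes "n > 0"
  shows "(\<Sum>k<n. ee (of_int m / of_nat n) ^ k) = (if int n dvd m then of_nat n else 0)"
proof -
  define w where "w = ee (of_int m / of_nat n)"
  have "w ^ n = ee (of_int m)"
    using assms by (simp add: w_def ee_def flip: exp_of_nat_mult)
  also have "\<dots> = 1"
    using ee_eq_iff[of "of_int m" 0] by (simp add: ee_def)
  finally have wn: "w ^ n = 1" .
  have w1: "w = 1 \<longleftrightarrow> int n dvd m"
  proof -
    have "w = 1 \<longleftrightarrow> ee (of_int m / of_nat n) = ee 0"
      by (simp add: w_def) (simp add: ee_def)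
    also have "\<dots> \<longleftrightarrow> (\<exists>i::int. (of_int m :: complex) = of_int (int n * i))"
      unfolding ee_eq_iff using assms by (simp add: field_simps)
    also have "\<dots> \<longleftrightarrow> int n dvd m"
      unfolding of_int_eq_iff dvd_def ..
    finally show ?thesis .
  qed
  have "(\<Sum>k<n. w ^ k) = 0" if "w \<noteq> 1"
    using that wn by (simp add: sum_gp_strict)
  then show ?thesis
    using w1 by (auto simp: w_def[symmetric])
qed

text \<open>
  Used with \<open>r = |p|\<close>, so that \<open>r ^ n = |q|\<close>, to place the first arguments of the A side in the annulus of
  Kronecker's expansion: they are products of \<open>n\<close> factors with moduli between \<open>|p|\<close> and 1.
\<close>

lemma power_product_between:
  fixes r x y :: real
  assumes "0 < r" "r < x" "x < 1" "r < y" "y < 1" "i + j = n" "n > 0"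
  shows "r ^ n < x ^ i * y ^ j" "x ^ i * y ^ j < 1"
proof -
  have *: "r ^ (i + j) < x ^ i * y ^ j \<and> x ^ i * y ^ j < 1" if "i + j > 0"
  proof (cases "i = 0")
    case True
    then show ?thesis using that assms
      by (auto intro: power_strict_mono simp: power_less_one_iff)
  next
    case False
    have "r ^ i * r ^ j < x ^ i * y ^ j"
      using False assms by (intro mult_less_le_imp_less power_strict_mono power_mono) auto
    moreover have "x ^ i * y ^ j \<le> x ^ i * 1"
      using assms by (intro mult_left_mono power_le_one) auto
    moreover have "x ^ i < 1"
      using False assms by (simp add: power_less_one_iff)
    ultimately show ?thesis by (simp add: power_add)
  qed
  then show "r ^ n < x ^ i * y ^ j" "x ^ i * y ^ j < 1"
    using assms by auto
qed

section \<open>The identity in the region of absolute convergence\<close>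

text \<open>
  The change of indices for the A side: the exponents \<open>(j + 1, - m)\<close> and \<open>(- j, m + 1)\<close> of
  \<open>(x, y)\<close> in the two bases, with \<open>n = m + j + 1\<close>, combine at \<open>u = a + j c\<close> and \<open>v = a + (j + 1) c\<close> to the
  exponents \<open>a\<close> and \<open>a + n c\<close>. Passing to exponentials makes it a linear identity.
\<close>

lemma power_int_monomial:
  fixes x y w :: complex
  assumes "x \<noteq> 0" "y \<noteq> 0" "w \<noteq> 0"
  shows "(x ^ Suc j / (y ^ m * w ^ j)) powi (a + int j * c) * (w ^ j * y ^ Suc m / x ^ j) powi (a + int (Suc j) * c)
       = x powi a * y powi (a + int (Suc (m + j)) * c) * (w powi c) ^ j"
proof -
  obtain \<alpha> \<beta> \<gamma> where e: "x = exp \<alpha>" "y = exp \<beta>" "w = exp \<gamma>"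
    using assms by (metis exp_Ln)
  have 1: "x ^ Suc j / (y ^ m * w ^ j) = exp (of_nat (Suc j) * \<alpha> - of_nat m * \<beta> - of_nat j * \<gamma>)"
    unfolding e by (simp only: exp_diff exp_of_nat_mult divide_divide_eq_left)
  have 2: "w ^ j * y ^ Suc m / x ^ j = exp (of_nat j * \<gamma> + of_nat (Suc m) * \<beta> - of_nat j * \<alpha>)"
    unfolding e by (simp only: exp_diff exp_add exp_of_nat_mult)
  show ?thesis
    unfolding 1 2 unfolding e
    by (simp only: exp_power_int exp_add[symmetric] exp_of_nat_mult[symmetric])
       (rule arg_cong[where f = exp], simp add: algebra_simps)
qed

lemma kterm_arg_nonzero:
  assumes "Im \<tau> > 0" "B \<noteq> 0" "jtheta (ee \<tau>) B \<noteq> 0"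
  shows "1 - B * ee \<tau> powi m \<noteq> 0"
proof
  assume "1 - B * ee \<tau> powi m = 0"
  then have "B = ee \<tau> powi (- m)"
    by (simp add: power_int_minus field_simps)
  with assms show False
    using jtheta_eq_0_iff[OF assms(1,2)] by blast
qed

text \<open>
  The region \<open>|p|\<^sup>n < |t1| < |p|\<^sup>n\<^sup>-\<^sup>1\<close>, \<open>|p| < |t2| < 1\<close>. With \<open>t1 = s p\<^sup>n\<^sup>-\<^sup>1\<close> it becomes
  \<open>|p| < |s|, |t2| < 1\<close>, and then \<open>s\<close>, \<open>t2\<close>, \<open>p / s\<close> and \<open>p / t2\<close> all have modulus between \<open>|p|\<close> and 1.
\<close>

locale theta_domain =
  fixes n :: nat and \<tau> p q s t1 t2 \<mu>1 \<mu>2 :: complex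
  assumes n: "n > 0" and \<tau>: "Im \<tau> > 0"
    and p: "p = ee (\<tau> / of_nat n)" and q: "q = ee \<tau>"
    and s: "norm p < norm s" "norm s < 1"
    and t2: "norm p < norm t2" "norm t2 < 1"
    and t1: "t1 = s * p ^ (n - 1)"
    and \<mu>: "\<mu>1 \<noteq> 0" "\<mu>2 \<noteq> 0"
    and regular: "\<And>j. j \<le> n \<Longrightarrow> jtheta q (\<mu>1 ^ (n - j) * \<mu>2 ^ j) \<noteq> 0"
begin

lemma nonzero: "p \<noteq> 0" "q \<noteq> 0" "s \<noteq> 0" "t1 \<noteq> 0" "t2 \<noteq> 0"
  using s t2 by (auto simp: p q t1)

lemma q_eq: "q = p ^ n"
  using n by (simp add: p q ee_def flip: exp_of_nat_mult)

lemma norm_q: "norm q < 1"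
  unfolding q by (rule norm_ee_less_1[OF \<tau>])

lemma norm_q_eq: "norm q = norm p ^ n"
  by (simp add: q_eq norm_power)

lemma p_less: "norm p < norm (p / s)" "norm (p / s) < 1" "norm p < norm (p / t2)" "norm (p / t2) < 1"
  using s t2 nonzero by (simp_all add: norm_divide field_simps)

definition z :: "int \<Rightarrow> complex" where "z c = \<mu>2 / \<mu>1 * q powi c"

definition X :: "int \<Rightarrow> complex" where "X a = \<mu>1 ^ n * q powi a"

definition monomial :: "int \<times> int \<Rightarrow> complex" where
  "monomial = (\<lambda>(a, c). t1 powi a * t2 powi (a + int n * c))"

lemma X_z: "j \<le> n \<Longrightarrow> X a * z c ^ j = \<mu>1 ^ (n - j) * \<mu>2 ^ j * q powi (a + int j * c)"
  using \<mu> nonzero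
  by (simp add: X_def z_def power_mult_distrib power_divide power_diff power_int_add power_int_mult
      mult.commute[of _ c] field_simps)

lemma X_z_nonzero: "j \<le> n \<Longrightarrow> 1 - X a * z c ^ j \<noteq> 0"
  unfolding X_z using kterm_arg_nonzero[OF \<tau>] regular \<mu> by (simp add: q)

lemma kron_product_has_sum:
  assumes "norm q < norm A" "norm A < 1" "norm q < norm A'" "norm A' < 1"
    and "B \<noteq> 0" "B' \<noteq> 0" "jtheta q B \<noteq> 0" "jtheta q B' \<noteq> 0"
  shows "((\<lambda>(u, v). kterm q A B u * kterm q A' B' v) has_sum (kron q A B * kron q A' B')) UNIV"
  using assms by (intro has_sum_product kronecker[OF \<tau> q]) auto

text \<open>
  The summand \<open>k = n - j\<close> of the A side. Its first arguments lie in the annulus only after the shifts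
  \<open>A1 = q\<^sup>j A1'\<close> and \<open>A2' = q\<^sup>j A2\<close>; these contribute \<open>(B2 / B1)\<^sup>j = (\<mu>2 / \<mu>1)\<^sup>j\<close>, and
  together with \<open>q\<^sup>j\<^sup>c\<close> from the change of indices this is the weight \<open>z\<^sup>j\<close> needed
  for telescoping.
\<close>

lemma A_summand_has_sum:
  assumes "n = Suc (m + j)"
  defines "A1 \<equiv> t1 ^ Suc j / t2 ^ m" and "A2 \<equiv> t2 ^ Suc m / t1 ^ j"
    and "B1 \<equiv> \<mu>1 ^ Suc m * \<mu>2 ^ j" and "B2 \<equiv> \<mu>1 ^ m * \<mu>2 ^ Suc j"
  shows "((\<lambda>(a, c). monomial (a, c) * (z c ^ j / ((1 - X a * z c ^ j) * (1 - X a * z c ^ Suc j)))) has_sum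
    (kron q A1 B1 * kron q A2 B2)) UNIV"
proof -
  define A1' A2' where "A1' = s ^ Suc j * (p / t2) ^ m" and "A2' = t2 ^ Suc m * (p / s) ^ j"
  have A1: "A1 = q ^ j * A1'"
    by (simp add: A1_def A1'_def t1 q_eq assms(1) power_mult_distrib power_divide power_add
        flip: power_mult)
  have A2: "A2' = q ^ j * A2"
    using nonzero
    by (simp add: A2_def A2'_def t1 q_eq assms(1) power_mult_distrib power_divide power_add field_simps
        flip: power_mult)
  have B_nz: "B1 \<noteq> 0" "B2 \<noteq> 0" using \<mu> by (simp_all add: B1_def B2_def)
  have A_nz: "A1' \<noteq> 0" "A2 \<noteq> 0" using nonzero by (simp_all add: A1'_def A2_def)
  have "kron q A1 B1 = kron q A1' B1 / B1 ^ j"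
    unfolding A1 using norm_q nonzero A_nz B_nz by (intro kron_shift_power) auto
  moreover have "kron q A2' B2 = kron q A2 B2 / B2 ^ j"
    unfolding A2 using norm_q nonzero A_nz B_nz by (intro kron_shift_power) auto
  ultimately have "kron q A1 B1 * kron q A2 B2 = (B2 / B1) ^ j * (kron q A1' B1 * kron q A2' B2)"
    using B_nz by (simp add: power_divide)
  also have "B2 / B1 = \<mu>2 / \<mu>1"
    using \<mu> by (simp add: B1_def B2_def)
  finally have prod: "kron q A1 B1 * kron q A2 B2 = (\<mu>2 / \<mu>1) ^ j * (kron q A1' B1 * kron q A2' B2)" .
  have "norm q < norm A1'" "norm A1' < 1"
    using power_product_between[of "norm p" "norm s" "norm (p / t2)" "Suc j" m n] s p_less nonzero n
    by (simp_all add: A1'_def norm_mult norm_power norm_q_eq assms(1) del: power_Suc)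
  moreover have "norm q < norm A2'" "norm A2' < 1"
    using power_product_between[of "norm p" "norm t2" "norm (p / s)" "Suc m" j n] t2 p_less nonzero n
    by (simp_all add: A2'_def norm_mult norm_power norm_q_eq assms(1) del: power_Suc)
  moreover have "jtheta q B1 \<noteq> 0" "jtheta q B2 \<noteq> 0"
    using regular[of j] regular[of "Suc j"] by (simp_all add: B1_def B2_def assms(1) Suc_diff_le)
  ultimately have "((\<lambda>(u, v). kterm q A1' B1 u * kterm q A2' B2 v) has_sum (kron q A1' B1 * kron q A2' B2)) UNIV"
    using B_nz by (intro kron_product_has_sum)
  then have "((\<lambda>uv. (\<mu>2 / \<mu>1) ^ j * (case uv of (u, v) \<Rightarrow> kterm q A1' B1 u * kterm q A2' B2 v)) has_sum
      (kron q A1 B1 * kron q A2 B2)) UNIV"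
    unfolding prod by (rule has_sum_cmult_right)
  also have "?this \<longleftrightarrow> ?thesis"
  proof (rule sym, rule has_sum_reindex_bij_witness
      [where j = "\<lambda>(a, c). (a + int j * c, a + int (Suc j) * c)" and i = "\<lambda>(u, v). (u - int j * (v - u), v - u)"])
    fix ac :: "int \<times> int"
    obtain a c where ac: "ac = (a, c)" by fastforce
    have A': "A1' = t1 ^ Suc j / (t2 ^ m * q ^ j)" "A2' = q ^ j * t2 ^ Suc m / t1 ^ j"
      using A1 A2 nonzero by (simp_all add: A1_def A2_def field_simps)
    have "A1' powi (a + int j * c) * A2' powi (a + int (Suc j) * c) = monomial (a, c) * (q powi c) ^ j"
      unfolding A' monomial_def using power_int_monomial[of t1 t2 q] nonzero assms(1) by simp
    moreover have "B1 * q powi (a + int j * c) = X a * z c ^ j"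
      by (subst X_z) (simp_all add: B1_def assms(1) Suc_diff_le)
    moreover have "B2 * q powi (a + int (Suc j) * c) = X a * z c ^ Suc j"
      by (subst X_z) (simp_all add: B2_def assms(1))
    moreover have "(\<mu>2 / \<mu>1) ^ j * (monomial (a, c) * (q powi c) ^ j) = monomial (a, c) * z c ^ j"
      by (simp add: z_def power_mult_distrib power_divide)
    ultimately show "(\<mu>2 / \<mu>1) ^ j * (case (case ac of (a, c) \<Rightarrow> (a + int j * c, a + int (Suc j) * c)) of
        (u, v) \<Rightarrow> kterm q A1' B1 u * kterm q A2' B2 v) =
      (case ac of (a, c) \<Rightarrow> monomial (a, c) * (z c ^ j / ((1 - X a * z c ^ j) * (1 - X a * z c ^ Suc j))))"
      unfolding ac kterm_def prod.case times_divide_times_eq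
      by (simp only: times_divide_eq_right)
  qed (auto simp: algebra_simps)
  finally show ?thesis .
qed

definition common_term :: "int \<times> int \<Rightarrow> complex" where
  "common_term = (\<lambda>(a, c). monomial (a, c) * ((\<Sum>l<n. z c ^ l) / ((1 - X a) * (1 - X a * z c ^ n))))"

lemma A_fun_has_sum: "(common_term has_sum A_fun n \<tau> t1 t2 \<mu>1 \<mu>2) UNIV"
proof -
  have A: "A_fun n \<tau> t1 t2 \<mu>1 \<mu>2 = (\<Sum>j<n. kron q (t1 ^ Suc j / t2 ^ (n - 1 - j)) (\<mu>1 ^ Suc (n - 1 - j) * \<mu>2 ^ j) *
      kron q (t2 ^ Suc (n - 1 - j) / t1 ^ j) (\<mu>1 ^ (n - 1 - j) * \<mu>2 ^ Suc j))"
    unfolding A_fun_def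
  proof (rule sum.reindex_bij_witness[where j = "\<lambda>k. n - k" and i = "\<lambda>j. n - j"])
    fix k assume "k \<in> {1..n}"
    then obtain m where m: "k = Suc m" "n = Suc (m + (n - k))"
      by (cases k) auto
    have e: "n - k + 1 = Suc (n - k)" "k - 1 = m" "n - 1 - (n - k) = m" "k = Suc m" using m by auto
    show "kron q (t1 ^ Suc (n - k) / t2 ^ (n - 1 - (n - k))) (\<mu>1 ^ Suc (n - 1 - (n - k)) * \<mu>2 ^ (n - k)) *
         kron q (t2 ^ Suc (n - 1 - (n - k)) / t1 ^ (n - k)) (\<mu>1 ^ (n - 1 - (n - k)) * \<mu>2 ^ Suc (n - k)) =
         delta \<tau> (t1 ^ (n - k + 1) / t2 ^ (k - 1)) (\<mu>1 ^ k * \<mu>2 ^ (n - k)) *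
         delta \<tau> (t2 ^ k / t1 ^ (n - k)) (\<mu>1 ^ (k - 1) * \<mu>2 ^ (n - k + 1))"
      unfolding e(1,2,3) using nonzero \<mu> by (simp add: delta_eq_kron[OF \<tau>] q m(1) del: power_Suc diff_Suc_Suc)
  qed (use n in auto)
  have "((\<lambda>ac. \<Sum>j<n. case ac of (a, c) \<Rightarrow> monomial (a, c) * (z c ^ j / ((1 - X a * z c ^ j) * (1 - X a * z c ^ Suc j))))
      has_sum A_fun n \<tau> t1 t2 \<mu>1 \<mu>2) UNIV"
    unfolding A by (intro has_sum_sum A_summand_has_sum) auto
  moreover have "(\<Sum>j<n. case ac of (a, c) \<Rightarrow> monomial (a, c) * (z c ^ j / ((1 - X a * z c ^ j) * (1 - X a * z c ^ Suc j)))) = common_term ac"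
    for ac
    unfolding common_term_def case_prod_beta'
    by (simp only: sum_distrib_left[symmetric] sum_geometric_telescope[OF X_z_nonzero])
  ultimately show ?thesis by simp
qed

text \<open>
  Both first arguments carry the same factor \<open>w = e(k/n) / p\<^sup>l\<close>, inverted in the second one,
  so it enters the term of index \<open>(a, b)\<close> as \<open>w\<^sup>a\<^sup>-\<^sup>b\<close>.
\<close>

lemma B_summand_has_sum:
  assumes "k < n" "l < n"
  shows "((\<lambda>(a, b). ee (of_int (a - b) / of_nat n) ^ k * (p powi (b - a)) ^ l *
      (t1 powi a * t2 powi b / ((1 - \<mu>1 ^ n * q powi a) * (1 - \<mu>2 ^ n * q powi b)))) has_sum
    (delta \<tau> (ee ((of_nat k - of_nat l * \<tau>) / of_nat n) * t1) (\<mu>1 ^ n) *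
     delta \<tau> (ee ((of_nat l * \<tau> - of_nat k) / of_nat n) * t2) (\<mu>2 ^ n))) UNIV"
proof -
  define w where "w = ee ((of_nat k - of_nat l * \<tau>) / of_nat n)"
  have w0: "w \<noteq> 0" by (simp add: w_def)
  have w': "ee ((of_nat l * \<tau> - of_nat k) / of_nat n) = 1 / w"
  proof -
    have "(of_nat l * \<tau> - of_nat k) / of_nat n = - ((of_nat k - of_nat l * \<tau>) / of_nat n)"
      by (simp add: minus_divide_left)
    then show ?thesis
      by (simp only: w_def ee_def mult_minus_right exp_minus field_class.field_divide_inverse mult_1)
  qed
  have wp: "w = ee (of_nat k / of_nat n) / p ^ l"
    by (simp add: w_def p ee_def diff_divide_distrib right_diff_distrib exp_diff flip: exp_of_nat_mult)
       (simp add: mult_ac)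
  have "norm (ee (of_nat k / of_nat n)) = 1"
    by (simp add: ee_def norm_exp_eq_Re)
  then have norm_w: "norm w = 1 / norm p ^ l"
    by (simp add: wp norm_divide norm_power)
  have wt1: "norm (w * t1) = norm s ^ 1 * norm p ^ (n - 1 - l)"
    using assms nonzero unfolding norm_mult norm_w t1 norm_power by (simp add: power_diff)
  have p1: "norm p < 1" using s by simp
  have pw: "norm p ^ n \<le> norm p ^ i" if "i \<le> n" for i
    using p1 that by (intro power_decreasing) auto
  have "norm p ^ n \<le> norm p ^ Suc (n - 1 - l)"
    using assms by (intro pw) auto
  also have "\<dots> < norm (w * t1)"
    unfolding wt1 using s nonzero by simp
  finally have 1: "norm q < norm (w * t1)" by (simp add: norm_q_eq)
  have "norm (w * t1) \<le> norm s * 1"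
    unfolding wt1 power_one_right using p1 by (intro mult_left_mono power_le_one) auto
  then have 2: "norm (w * t1) < 1" using s by simp
  have wt2: "norm (t2 / w) = norm t2 * norm p ^ l"
    by (simp add: norm_divide norm_w)
  have "norm p ^ n \<le> norm p ^ Suc l"
    using assms by (intro pw) auto
  also have "\<dots> < norm (t2 / w)"
    unfolding wt2 using t2 nonzero by simp
  finally have 3: "norm q < norm (t2 / w)" by (simp add: norm_q_eq)
  have "norm (t2 / w) \<le> norm t2 * 1"
    unfolding wt2 using p1 by (intro mult_left_mono power_le_one) auto
  then have 4: "norm (t2 / w) < 1" using t2 by simp
  have "((\<lambda>(a, b). kterm q (w * t1) (\<mu>1 ^ n) a * kterm q (t2 / w) (\<mu>2 ^ n) b) has_sum
      (kron q (w * t1) (\<mu>1 ^ n) * kron q (t2 / w) (\<mu>2 ^ n))) UNIV"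
    using \<mu> regular[of 0] regular[of n] by (intro kron_product_has_sum 1 2 3 4) auto
  also have "kron q (w * t1) (\<mu>1 ^ n) * kron q (t2 / w) (\<mu>2 ^ n) =
      delta \<tau> (w * t1) (\<mu>1 ^ n) * delta \<tau> (1 / w * t2) (\<mu>2 ^ n)"
    using nonzero \<mu> w0 by (simp add: delta_eq_kron[OF \<tau>] q)
  also have "(\<lambda>(a, b). kterm q (w * t1) (\<mu>1 ^ n) a * kterm q (t2 / w) (\<mu>2 ^ n) b) =
      (\<lambda>(a, b). ee (of_int (a - b) / of_nat n) ^ k * (p powi (b - a)) ^ l *
      (t1 powi a * t2 powi b / ((1 - \<mu>1 ^ n * q powi a) * (1 - \<mu>2 ^ n * q powi b))))"
  proof (intro ext, clarify)
    fix a b :: int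
    have "w powi (a - b) = ee (of_int (a - b) / of_nat n) ^ k * (p powi (b - a)) ^ l"
    proof -
      have "ee (of_nat k / of_nat n) powi (a - b) = ee (of_int (a - b) / of_nat n) ^ k"
        by (simp add: ee_def exp_power_int flip: exp_of_nat_mult) (simp add: mult_ac)
      moreover have "(p ^ l) powi (b - a) = (p powi (b - a)) ^ l"
        by (simp add: power_int_power power_int_power' mult.commute)
      moreover have "(p ^ l) powi (b - a) = inverse ((p ^ l) powi (a - b))"
        by (simp flip: power_int_minus)
      ultimately show ?thesis
        by (simp add: wp power_int_mult_distrib power_int_inverse field_class.field_divide_inverse)
    qed
    moreover have "(w * t1) powi a * (t2 / w) powi b = w powi (a - b) * (t1 powi a * t2 powi b)"
      using w0 by (simp add: power_int_mult_distrib power_int_divide_distrib power_int_diff)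
    ultimately show "kterm q (w * t1) (\<mu>1 ^ n) a * kterm q (t2 / w) (\<mu>2 ^ n) b =
      ee (of_int (a - b) / of_nat n) ^ k * (p powi (b - a)) ^ l *
      (t1 powi a * t2 powi b / ((1 - \<mu>1 ^ n * q powi a) * (1 - \<mu>2 ^ n * q powi b)))"
      by (simp add: kterm_def)
  qed
  finally show ?thesis
    by (simp only: w_def[symmetric] w')
qed

text \<open>
  The sum over \<open>k\<close> of the powers of the root of unity \<open>e((a - b)/n)\<close> cancels the factor \<open>1/n\<close>
  if \<open>n\<close> divides \<open>a - b\<close>, and annihilates the term otherwise. In the remaining terms
  \<open>b = a + n c\<close>, and \<open>p\<^sup>b\<^sup>-\<^sup>a = q\<^sup>c\<close>.
\<close>

lemma B_fun_has_sum: "(common_term has_sum B_fun n \<tau> t1 t2 \<mu>1 \<mu>2) UNIV"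
proof -
  define C where "C = (\<lambda>(a, b). t1 powi a * t2 powi b / ((1 - \<mu>1 ^ n * q powi a) * (1 - \<mu>2 ^ n * q powi b)))"
  define E where "E = (\<lambda>(a, b). ee (of_int (a - b) / of_nat n))"
  define P where "P = (\<lambda>(a, b :: int). p powi (b - a))"
  define r where "r = \<mu>2 / \<mu>1"
  have "((\<lambda>ab. 1 / of_nat n * (\<Sum>k=0..<n. \<Sum>l=0..<n. r ^ l * (E ab ^ k * P ab ^ l * C ab))) has_sum
      B_fun n \<tau> t1 t2 \<mu>1 \<mu>2) UNIV"
    unfolding B_fun_def mult.assoc[of "(\<mu>2 / \<mu>1) ^ _"] r_def
    using B_summand_has_sum
    by (intro has_sum_cmult_right has_sum_sum) (auto simp: E_def P_def C_def case_prod_beta')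
  also have "(\<lambda>ab. 1 / of_nat n * (\<Sum>k=0..<n. \<Sum>l=0..<n. r ^ l * (E ab ^ k * P ab ^ l * C ab))) =
      (\<lambda>(a, b). if int n dvd a - b then C (a, b) * (\<Sum>l<n. (r * P (a, b)) ^ l) else 0)"
  proof (intro ext, clarify)
    fix a b :: int
    have "(\<Sum>k=0..<n. \<Sum>l=0..<n. r ^ l * (E (a, b) ^ k * P (a, b) ^ l * C (a, b))) =
        C (a, b) * (\<Sum>k<n. E (a, b) ^ k) * (\<Sum>l<n. (r * P (a, b)) ^ l)"
      by (simp add: sum_distrib_left sum_distrib_right power_mult_distrib mult_ac atLeast0LessThan)
    then show "1 / of_nat n * (\<Sum>k=0..<n. \<Sum>l=0..<n. r ^ l * (E (a, b) ^ k * P (a, b) ^ l * C (a, b))) =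
      (if int n dvd a - b then C (a, b) * (\<Sum>l<n. (r * P (a, b)) ^ l) else 0)"
      using sum_roots_of_unity[OF n, of "a - b"] n by (simp add: E_def)
  qed
  also have "(\<dots> has_sum B_fun n \<tau> t1 t2 \<mu>1 \<mu>2) UNIV \<longleftrightarrow>
      ((\<lambda>(a, b). C (a, b) * (\<Sum>l<n. (r * P (a, b)) ^ l)) has_sum B_fun n \<tau> t1 t2 \<mu>1 \<mu>2) {(a, b). int n dvd a - b}"
    by (rule has_sum_cong_neutral) auto
  also have "\<dots> \<longleftrightarrow> (common_term has_sum B_fun n \<tau> t1 t2 \<mu>1 \<mu>2) UNIV"
  proof (rule sym, rule has_sum_reindex_bij_witness
      [where j = "\<lambda>(a, c). (a, a + int n * c)" and i = "\<lambda>(a, b). (a, (b - a) div int n)"])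
    fix ab assume "ab \<in> {(a, b). int n dvd a - b}"
    then show "(case case ab of (a, b) \<Rightarrow> (a, (b - a) div int n) of (a, c) \<Rightarrow> (a, a + int n * c)) = ab"
      by (auto simp: dvd_diff_commute)
  next
    fix ac :: "int \<times> int"
    obtain a c where ac: "ac = (a, c)" by fastforce
    have "P (a, a + int n * c) = q powi c"
      using nonzero by (simp add: P_def q_eq power_int_mult)
    then have "r * P (a, a + int n * c) = z c"
      by (simp add: r_def z_def)
    moreover have "\<mu>2 ^ n * q powi (a + int n * c) = X a * z c ^ n"
      by (subst X_z) simp_all
    ultimately show "(case (case ac of (a, c) \<Rightarrow> (a, a + int n * c)) of (a, b) \<Rightarrow> C (a, b) * (\<Sum>l<n. (r * P (a, b)) ^ l)) = common_term ac"
      by (simp add: ac common_term_def C_def monomial_def X_def[symmetric])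
  qed (use n in auto)
  finally show ?thesis .
qed

lemma A_fun_eq_B_fun: "A_fun n \<tau> t1 t2 \<mu>1 \<mu>2 = B_fun n \<tau> t1 t2 \<mu>1 \<mu>2"
  using A_fun_has_sum B_fun_has_sum by (rule has_sum_unique)

end

section \<open>Analytic continuation\<close>

lemma holomorphic_kron [holomorphic_intros]:
  assumes "norm q < 1" "f holomorphic_on S" "g holomorphic_on S"
    and "\<And>x. x \<in> S \<Longrightarrow> f x \<noteq> 0 \<and> jtheta q (f x) \<noteq> 0"
    and "\<And>x. x \<in> S \<Longrightarrow> g x \<noteq> 0 \<and> jtheta q (g x) \<noteq> 0"
  shows "(\<lambda>x. kron q (f x) (g x)) holomorphic_on S"
  unfolding kron_def using assms by (intro holomorphic_intros) auto

theorem theorem2p1: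
  fixes n :: nat and \<tau> t1 t2 \<mu>1 \<mu>2 :: complex
  assumes "n > 0"
    and "Im \<tau> > 0"
    and "t1 \<noteq> 0" "t2 \<noteq> 0" "\<mu>1 \<noteq> 0" "\<mu>2 \<noteq> 0"
    and "A_regular n \<tau> t1 t2 \<mu>1 \<mu>2"
    and "B_regular n \<tau> t1 t2 \<mu>1 \<mu>2"
  shows "A_fun n \<tau> t1 t2 \<mu>1 \<mu>2 = B_fun n \<tau> t1 t2 \<mu>1 \<mu>2"
proof -
  note n = assms(1) and \<tau> = assms(2) and nz = assms(3-6)
  define q p where "q = ee \<tau>" and "p = ee (\<tau> / of_nat n)"
  have q: "norm q < 1"
    unfolding q_def by (rule norm_ee_less_1[OF \<tau>])
  have delta: "delta \<tau> A B = - kron q A B" if "A \<noteq> 0" "B \<noteq> 0" for A B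
    unfolding q_def by (rule delta_eq_kron[OF \<tau> that])
  \<comment> \<open>The summands \<open>k = 1, \<dots>, n\<close> of the A side give this for \<open>j = n - k\<close> through their first factor; \<open>j = n\<close> comes from the second factor of \<open>k = 1\<close>.\<close>
  have regular: "jtheta q (\<mu>1 ^ (n - j) * \<mu>2 ^ j) \<noteq> 0" if "j \<le> n" for j
  proof (cases "j = n")
    case True
    have "1 \<in> {1..n}" using n by simp
    with assms(7) have "delta_regular \<tau> (t2 ^ 1 / t1 ^ (n - 1)) (\<mu>1 ^ (1 - 1) * \<mu>2 ^ (n - 1 + 1))"
      unfolding A_regular_def by blast
    with True n show ?thesis by (simp add: delta_regular_iff_jtheta[OF \<tau>] q_def)
  next
    case False
    with that have "n - j \<in> {1..n}" by simp
    with assms(7) have "delta_regular \<tau> (t1 ^ (n - (n - j) + 1) / t2 ^ (n - j - 1)) (\<mu>1 ^ (n - j) * \<mu>2 ^ (n - (n - j)))"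
      unfolding A_regular_def by blast
    with that show ?thesis by (simp add: delta_regular_iff_jtheta[OF \<tau>] q_def)
  qed
  \<comment> \<open>A line in logarithmic coordinates from \<open>(t1, t2)\<close> at \<open>v = 0\<close> to the point of the convergence region at \<open>v = 1\<close> with logarithms \<open>\<tau> - \<tau> / (2 n)\<close> and \<open>\<tau> / (2 n)\<close>.\<close>
  define x where "x = (\<lambda>v. ee (lg t1 + v * (\<tau> - \<tau> / (2 * of_nat n) - lg t1)))"
  define y where "y = (\<lambda>v. ee (lg t2 + v * (\<tau> / (2 * of_nat n) - lg t2)))"
  have xy0: "x 0 = t1" "y 0 = t2"
    using nz by (simp_all add: x_def y_def ee_lg)
  have xy_nz [simp]: "x v \<noteq> 0" "y v \<noteq> 0" for v
    by (simp_all add: x_def y_def)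
  have xy_hol: "x holomorphic_on W" "y holomorphic_on W" for W
    unfolding x_def y_def ee_def by (auto intro!: holomorphic_intros)
  \<comment> \<open>\<open>D\<close> collects all denominators that vary along the line.\<close>
  define D where "D = (\<lambda>v. (\<Prod>k=1..n. jtheta q (x v ^ (n - k + 1) / y v ^ (k - 1)) * jtheta q (y v ^ k / x v ^ (n - k))) *
    (\<Prod>k=0..<n. \<Prod>l=0..<n. jtheta q (ee ((of_nat k - of_nat l * \<tau>) / of_nat n) * x v) *
       jtheta q (ee ((of_nat l * \<tau> - of_nat k) / of_nat n) * y v)))"
  have D_hol: "D holomorphic_on UNIV"
    unfolding D_def using q by (intro holomorphic_intros xy_hol) auto
  have "D 0 \<noteq> 0"
    using assms(7,8) unfolding D_def xy0 A_regular_def B_regular_def delta_regular_iff_jtheta[OF \<tau>] q_def[symmetric]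
    by (auto simp: prod_zero_iff)
  define S where "S = {v. D v \<noteq> 0}"
  define f where "f = (\<lambda>v. A_fun n \<tau> (x v) (y v) \<mu>1 \<mu>2)"
  define g where "g = (\<lambda>v. B_fun n \<tau> (x v) (y v) \<mu>1 \<mu>2)"
  have jA: "jtheta q (x v ^ (n - k + 1) / y v ^ (k - 1)) \<noteq> 0 \<and> jtheta q (y v ^ k / x v ^ (n - k)) \<noteq> 0"
    if "v \<in> S" "k \<in> {1..n}" for v k
    using that unfolding S_def D_def by (force simp: prod_zero_iff)
  have jB: "jtheta q (ee ((of_nat k - of_nat l * \<tau>) / of_nat n) * x v) \<noteq> 0 \<and>
       jtheta q (ee ((of_nat l * \<tau> - of_nat k) / of_nat n) * y v) \<noteq> 0"
    if "v \<in> S" "k \<in> {0..<n}" "l \<in> {0..<n}" for v k l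
    using that unfolding S_def D_def by (force simp: prod_zero_iff)
  have f_hol: "f holomorphic_on S"
  proof -
    have "jtheta q (\<mu>1 ^ k * \<mu>2 ^ (n - k)) \<noteq> 0 \<and> jtheta q (\<mu>1 ^ (k - 1) * \<mu>2 ^ (n - k + 1)) \<noteq> 0" if "k \<in> {1..n}" for k
    proof -
      have "n - (n - k) = k" "n - (n - k + 1) = k - 1" "n - k + 1 \<le> n" using that by auto
      then show ?thesis
        using regular[of "n - k"] regular[of "n - k + 1"] by simp
    qed
    then show ?thesis
      unfolding f_def A_fun_def using q jA nz
      by (subst delta, simp, simp, subst delta, simp, simp) (intro holomorphic_intros xy_hol; simp)
  qed
  have g_hol: "g holomorphic_on S"
    unfolding g_def B_fun_def using q jB nz regular[of 0] regular[of n]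
    by (subst delta, simp, simp, subst delta, simp, simp) (intro holomorphic_intros xy_hol; simp)
  \<comment> \<open>An entire function that does not vanish at 0 has countably many zeros; removing them leaves the plane connected.\<close>
  have countable: "countable {v. D v = 0}"
  proof (cases "D constant_on UNIV")
    case True
    then have "{v. D v = 0} = {}"
      using \<open>D 0 \<noteq> 0\<close> by (auto simp: constant_on_def)
    then show ?thesis by simp
  next
    case False
    then show ?thesis
      using holomorphic_countable_zeros[OF D_hol] connected_UNIV by simp
  qed
  have S_eq: "S = UNIV - {v. D v = 0}" by (auto simp: S_def)
  have S_open: "open S"
    unfolding S_def using D_hol
    by (intro open_Collect_neq continuous_on_const holomorphic_on_imp_continuous_on)
  have S_conn: "connected S"
    unfolding S_eq using countable by (intro connected_open_diff_countable) auto
  define W where "W = {v. norm q < norm (x v) \<and> norm (x v) < norm p ^ (n - 1) \<and> norm p < norm (y v) \<and> norm (y v) < 1}"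
  have "open W"
  proof -
    have "continuous_on UNIV x" "continuous_on UNIV y"
      using xy_hol by (auto intro: holomorphic_on_imp_continuous_on)
    then show ?thesis
      unfolding W_def by (intro open_Collect_conj open_Collect_less continuous_intros)
  qed
  have q_eq: "q = p ^ n"
    using n by (simp add: p_def q_def ee_def flip: exp_of_nat_mult)
  have "p \<noteq> 0" by (simp add: p_def)
  have eq: "f v = g v" if "v \<in> W" for v
    unfolding f_def g_def
  proof (rule theta_domain.A_fun_eq_B_fun[where p = p and q = q and s = "x v / p ^ (n - 1)"], unfold_locales)
    have "norm p * norm p ^ (n - 1) = norm q"
      using n by (cases n) (simp_all add: q_eq norm_power norm_mult)
    with that \<open>p \<noteq> 0\<close> show "norm p < norm (x v / p ^ (n - 1))" "norm (x v / p ^ (n - 1)) < 1"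
      by (simp_all add: W_def norm_divide norm_power field_simps)
    show "x v = x v / p ^ (n - 1) * p ^ (n - 1)" using \<open>p \<noteq> 0\<close> by simp
  qed (use n \<tau> nz regular that in \<open>auto simp: p_def q_def W_def\<close>)
  have "1 \<in> W"
  proof -
    define h where "h = ee (\<tau> / (2 * of_nat n))"
    have "Im (\<tau> / (2 * of_nat n)) = Im \<tau> / real (2 * n)"
      using Im_divide_of_nat[of \<tau> "2 * n"] by simp
    then have h: "norm h < 1" "norm h > 0" "h \<noteq> 0"
      using n \<tau> unfolding h_def by (intro norm_ee_less_1) simp_all
    have "p = h ^ 2" "q = h ^ (2 * n)"
      using n by (simp_all add: p_def q_def h_def ee_def mult.assoc flip: exp_of_nat_mult)
    moreover have "x 1 = h ^ (2 * n - 1)"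
    proof -
      have "x 1 = q / h" by (simp add: x_def q_def h_def ee_def right_diff_distrib exp_diff)
      also have "\<dots> = h ^ (2 * n - 1)"
        using n h(3) by (simp add: \<open>q = h ^ (2 * n)\<close> power_diff)
      finally show ?thesis .
    qed
    moreover have "y 1 = h ^ 1" by (simp add: y_def h_def)
    moreover have "norm h ^ (2 * n) < norm h ^ (2 * n - 1)" "norm h ^ (2 * n - 1) < norm h ^ (2 * (n - 1))"
      "norm h ^ 2 < norm h ^ 1"
      using n h by (intro power_strict_decreasing; simp)+
    ultimately show ?thesis
      using h(1) by (simp add: W_def norm_power power_mult)
  qed
  then obtain e where "e > 0" "ball 1 e \<subseteq> W"
    using \<open>open W\<close> open_contains_ball by blast
  then have "\<not> W \<subseteq> {v. D v = 0}"
    using countable uncountable_ball[of e "1 :: complex"] by (meson countable_subset)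
  then obtain v where "v \<in> W \<inter> S"
    by (auto simp: S_def)
  then have "W \<inter> S \<noteq> {}" by blast
  have "f 0 = g 0"
  proof (rule analytic_continuation_open[OF _ S_open \<open>W \<inter> S \<noteq> {}\<close> S_conn Int_lower2 f_hol g_hol])
    show "open (W \<inter> S)" using \<open>open W\<close> S_open by (rule open_Int)
    show "f v = g v" if "v \<in> W \<inter> S" for v using eq that by blast
    show "0 \<in> S" using \<open>D 0 \<noteq> 0\<close> by (simp add: S_def)
  qed
  then show ?thesis
    by (simp add: f_def g_def xy0)
qed

end
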